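(* Let $n\in\mathbb N$ and let $\mu$ be a Carleson measure for $H^n_{2,\rho}(T_\Omega)$. Then there exists a constant $C>0$ such that $$\int_{T_\Omega}|K^{(n,\rho)}_w(z)|^2\,d\mu(z)\le C\,K^{(n,\rho)}(w,w)$$ for all $w\in T_\Omega$.
   Context: Let $d\ge 1$ and let $\Omega\subset\mathbb R^d$ be a nonempty open convex cone containing no complete straight line. Its dual cone is $\Omega^\ast=\{\xi\in\mathbb R^d:\langle x,\xi\rangle\ge 0\text{ for all }x\in\Omega\}$, and $T_\Omega=\mathbb R^d+i\Omega\subset\mathbb C^d$ is the associated tube domain. For $z\in\mathbb C^d$, $\xi\in\mathbb R^d$, $\langle z,\xi\rangle=\sum_{j=1}^d z_j\xi_j$ (bilinear). Fix a continuous function $\rho:\Omega^\ast\to[0,\infty)$ with $\rho(\xi)>0$ for $\xi\ne 0$ and $\rho(t\xi)=t\rho(\xi)$ for all $t>0$, $\xi\in\Omega^\ast$ (so $\rho(0)=0$). For $n\in\mathbb N$ let $w_n(\xi)=\sum_{k=0}^n\rho(\xi)^{2k}$, and let $L^2(\Omega^\ast,w_n)$ be the space of (classes of) measurable complex functions $f$ on $\Omega^\ast$ with $\|f\|_{L^2(\Omega^\ast,w_n)}^2=\int_{\Omega^\ast}|f|^2w_n\,d\xi<\infty$. The Hilbertian Hardy--Sobolev space $H^n_{2,\rho}(T_\Omega)$ consists of all holomorphic functions on $T_\Omega$ of the form $\mathcal Lf(z)=\int_{\Omega^\ast}e^{i\langle z,\xi\rangle}f(\xi)\,d\xi$ with $f\in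 L^2(\Omega^\ast,w_n)$. The map $\mathcal L$ is injective on $L^2(\Omega^\ast,w_n)$, and $H^n_{2,\rho}(T_\Omega)$ is a Hilbert space with inner product $\langle\mathcal Lf,\mathcal Lg\rangle=\int_{\Omega^\ast}f\overline g\,w_n\,d\xi$. Point evaluations at points of $T_\Omega$ are bounded on it. For $w\in T_\Omega$, $K^{(n,\rho)}_w\in H^n_{2,\rho}(T_\Omega)$ denotes the unique function with $F(w)=\langle F,K^{(n,\rho)}_w\rangle$ for all $F\in H^n_{2,\rho}(T_\Omega)$, and $K^{(n,\rho)}(z,w):=K^{(n,\rho)}_w(z)$. A positive Borel measure $\mu$ on $T_\Omega$ is a Carleson measure for $H^n_{2,\rho}(T_\Omega)$ if there is $C>0$ with $\int_{T_\Omega}|F|^2\,d\mu\le C\|F\|^2_{H^n_{2,\rho}(T_\Omega)}$ for all $F\in H^n_{2,\rho}(T_\Omega)$. *)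

theory Defs
  imports "HOL-Analysis.Analysis"
begin

definition dual_cone :: "(real ^ 'd) set \<Rightarrow> (real ^ 'd) set" where
  "dual_cone \<Omega> = {\<xi>. \<forall>x\<in>\<Omega>. 0 \<le> x \<bullet> \<xi>}"

definition tube :: "(real ^ 'd) set \<Rightarrow> (complex ^ 'd) set" where
  "tube \<Omega> = {z. (\<chi> j. Im (z $ j)) \<in> \<Omega>}"

definition bilin :: "complex ^ 'd \<Rightarrow> real ^ 'd \<Rightarrow> complex" where
  "bilin z \<xi> = (\<Sum>j\<in>UNIV. z $ j * complex_of_real (\<xi> $ j))"

(* The library constant cone is not used: it requires closure under scaling by 0,
   which would force 0 into the open cone. *)
definition open_pointed_cone :: "(real ^ 'd) set \<Rightarrow> bool" where
  "open_pointed_cone \<Omega> \<longleftrightarrow>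
     \<Omega> \<noteq> {} \<and> open \<Omega> \<and> convex \<Omega> \<and>
     (\<forall>x\<in>\<Omega>. \<forall>t>0. t *\<^sub>R x \<in> \<Omega>) \<and>
     \<not> (\<exists>x v. v \<noteq> 0 \<and> (\<forall>t. x + t *\<^sub>R v \<in> \<Omega>))"

(* Only the values of \<rho> on the dual cone matter. *)
definition admissible_gauge :: "(real ^ 'd) set \<Rightarrow> (real ^ 'd \<Rightarrow> real) \<Rightarrow> bool" where
  "admissible_gauge \<Omega> \<rho> \<longleftrightarrow>
     continuous_on (dual_cone \<Omega>) \<rho> \<and>
     (\<forall>\<xi>\<in>dual_cone \<Omega>. 0 \<le> \<rho> \<xi>) \<and>
     (\<forall>\<xi>\<in>dual_cone \<Omega>. \<xi> \<noteq> 0 \<longrightarrow> 0 < \<rho> \<xi>) \<and>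
     (\<forall>\<xi>\<in>dual_cone \<Omega>. \<forall>t>0. \<rho> (t *\<^sub>R \<xi>) = t * \<rho> \<xi>)"

definition hs_weight :: "(real ^ 'd \<Rightarrow> real) \<Rightarrow> nat \<Rightarrow> real ^ 'd \<Rightarrow> real" where
  "hs_weight \<rho> n \<xi> = (\<Sum>k\<le>n. \<rho> \<xi> ^ (2 * k))"

(* Representatives of the classes in the weighted space. *)
definition weighted_L2 ::
  "(real ^ 'd) set \<Rightarrow> (real ^ 'd \<Rightarrow> real) \<Rightarrow> nat \<Rightarrow> (real ^ 'd \<Rightarrow> complex) set" where
  "weighted_L2 \<Omega> \<rho> n =
     {f \<in> borel_measurable (lebesgue_on (dual_cone \<Omega>)).
        integrable (lebesgue_on (dual_cone \<Omega>)) (\<lambda>\<xi>. (cmod (f \<xi>))\<^sup>2 * hs_weight \<rho> n \<xi>)}"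

definition laplace ::
  "(real ^ 'd) set \<Rightarrow> (real ^ 'd \<Rightarrow> complex) \<Rightarrow> complex ^ 'd \<Rightarrow> complex" where
  "laplace \<Omega> f z = (LINT \<xi>|lebesgue_on (dual_cone \<Omega>). exp (\<i> * bilin z \<xi>) * f \<xi>)"

(* Holomorphy in several variables on an open set: the real Frechet derivative exists
   and is complex linear. *)
definition holomorphic_several :: "(complex ^ 'd \<Rightarrow> complex) \<Rightarrow> (complex ^ 'd) set \<Rightarrow> bool" where
  "holomorphic_several F U \<longleftrightarrow>
     (\<forall>z\<in>U. \<exists>D. (F has_derivative D) (at z) \<and> (\<forall>c v. D (c *s v) = c * D v))"

(* A function on the tube is encoded by its extensional representative, so that
   equality of functions is equality on the tube. *)
definition hardy_sobolev ::
  "(real ^ 'd) set \<Rightarrow> (real ^ 'd \<Rightarrow> real) \<Rightarrow> nat \<Rightarrow> (complex ^ 'd \<Rightarrow> complex) set" where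
  "hardy_sobolev \<Omega> \<rho> n =
     {F \<in> extensional (tube \<Omega>). holomorphic_several F (tube \<Omega>) \<and>
        (\<exists>f\<in>weighted_L2 \<Omega> \<rho> n. \<forall>z\<in>tube \<Omega>. F z = laplace \<Omega> f z)}"

(* Inverse of the Laplace transform on the Hardy-Sobolev space. The transform is injective
   up to null sets, so the choice of representative does not affect the inner product. *)
definition hs_density ::
  "(real ^ 'd) set \<Rightarrow> (real ^ 'd \<Rightarrow> real) \<Rightarrow> nat \<Rightarrow> (complex ^ 'd \<Rightarrow> complex) \<Rightarrow>
     real ^ 'd \<Rightarrow> complex" where
  "hs_density \<Omega> \<rho> n F =
     (SOME f. f \<in> weighted_L2 \<Omega> \<rho> n \<and> (\<forall>z\<in>tube \<Omega>. F z = laplace \<Omega> f z))"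

definition hs_inner ::
  "(real ^ 'd) set \<Rightarrow> (real ^ 'd \<Rightarrow> real) \<Rightarrow> nat \<Rightarrow>
     (complex ^ 'd \<Rightarrow> complex) \<Rightarrow> (complex ^ 'd \<Rightarrow> complex) \<Rightarrow> complex" where
  "hs_inner \<Omega> \<rho> n F G =
     (LINT \<xi>|lebesgue_on (dual_cone \<Omega>).
        hs_density \<Omega> \<rho> n F \<xi> * cnj (hs_density \<Omega> \<rho> n G \<xi>) * complex_of_real (hs_weight \<rho> n \<xi>))"

definition hs_norm ::
  "(real ^ 'd) set \<Rightarrow> (real ^ 'd \<Rightarrow> real) \<Rightarrow> nat \<Rightarrow> (complex ^ 'd \<Rightarrow> complex) \<Rightarrow> real" where
  "hs_norm \<Omega> \<rho> n F = sqrt (Re (hs_inner \<Omega> \<rho> n F F))"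

definition hs_kernel_at ::
  "(real ^ 'd) set \<Rightarrow> (real ^ 'd \<Rightarrow> real) \<Rightarrow> nat \<Rightarrow> complex ^ 'd \<Rightarrow> complex ^ 'd \<Rightarrow> complex" where
  "hs_kernel_at \<Omega> \<rho> n w =
     (THE G. G \<in> hardy_sobolev \<Omega> \<rho> n \<and>
        (\<forall>F\<in>hardy_sobolev \<Omega> \<rho> n. F w = hs_inner \<Omega> \<rho> n F G))"

definition hs_kernel ::
  "(real ^ 'd) set \<Rightarrow> (real ^ 'd \<Rightarrow> real) \<Rightarrow> nat \<Rightarrow> complex ^ 'd \<Rightarrow> complex ^ 'd \<Rightarrow> complex" where
  "hs_kernel \<Omega> \<rho> n z w = hs_kernel_at \<Omega> \<rho> n w z"

definition carleson_measure ::
  "(real ^ 'd) set \<Rightarrow> (real ^ 'd \<Rightarrow> real) \<Rightarrow> nat \<Rightarrow> (complex ^ 'd) measure \<Rightarrow> bool" where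
  "carleson_measure \<Omega> \<rho> n \<mu> \<longleftrightarrow>
     sets \<mu> = sets (restrict_space borel (tube \<Omega>)) \<and>
     (\<exists>C>0. \<forall>F\<in>hardy_sobolev \<Omega> \<rho> n.
        (\<integral>\<^sup>+ z. ennreal ((cmod (F z))\<^sup>2) \<partial>\<mu>) \<le> ennreal (C * (hs_norm \<Omega> \<rho> n F)\<^sup>2))"

end

theory Submission
  imports Defs "HOL-Real_Asymp.Real_Asymp"
begin

text \<open>
  The functions \<open>K\<^sub>w\<close> belong to the Hardy--Sobolev space and satisfy \<open>\<langle>K\<^sub>w, K\<^sub>w\<rangle> = K\<^sub>w(w) = K(w, w)\<close>. The Carleson
  inequality for \<open>F = K\<^sub>w\<close> is therefore already the claimed bound, with the Carleson constant itself as \<open>C\<close>.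

  What has to be shown is that \<open>K\<^sub>w\<close> is well defined, that is, that exactly one function of the space reproduces
  the values at \<open>w\<close>. A candidate is the Laplace transform of the density \<open>cnj (exp (i \<langle>w, \<xi>\<rangle>)) / w\<^sub>n(\<xi>)\<close>. As \<open>w\<close>
  lies over an interior point of the cone, the exponential decays like \<open>exp (- c * norm \<xi>)\<close> on the dual cone
  (\<open>dual_cone_coercive\<close>), so the density is square integrable. Its Laplace transform is holomorphic by
  differentiation under the integral (\<open>holomorphic_several_laplace\<close>). The reproducing property
  (\<open>kernel_reproducing\<close>) is a one-line computation once densities are known to be unique almost everywhere.
  Uniqueness of the reproducing function (\<open>reproducing_unique\<close>) is the usual Hilbert space argument.

  The substantial point is the injectivity of the Laplace transform (\<open>laplace_injective\<close>). It is obtained from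
  the points \<open>i m\<close>, with \<open>m\<close> in the cone, by reduction to a moment problem on a cube: the
  exponentials \<open>u\<^sub>j = exp (- \<langle>Y\<^sub>j, \<xi>\<rangle>)\<close> for a basis \<open>Y\<^sub>j\<close> contained in the cone embed the dual cone into the unit
  cube, and the vanishing of the transform says that all monomials in the \<open>u\<^sub>j\<close> integrate to zero against
  \<open>exp (- \<langle>m, \<xi>\<rangle>) f\<close>. By the Stone--Weierstrass theorem so do all continuous functions of the \<open>u\<^sub>j\<close>, and by a
  limit all indicators of compact sets, which forces \<open>f = 0\<close> almost everywhere.
\<close>

section \<open>Integration on Euclidean space\<close>

text \<open>
  Cut the space into the shells \<open>k \<le> norm x \<le> k + 1\<close>: on each the function is at most
  \<open>exp (- c * k)\<close>, while the volume of the enclosing ball grows only polynomially in \<open>k\<close>.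
\<close>
lemma integrable_exp_neg_norm_lborel:
  assumes "c > 0"
  shows "integrable lborel (\<lambda>x::'a::euclidean_space. exp (- c * norm x))"
proof (rule integrableI_bounded)
  have term_le_suminf: "u k \<le> (\<Sum>k. u k)" for u :: "nat \<Rightarrow> ennreal" and k
    using sum_le_suminf[OF summableI, of "{k}" u] by simp
  define N where "N = DIM('a)"
  define a where "a = (\<lambda>k::nat. exp (- c * real k) * (unit_ball_vol (real N) * (real k + 1) ^ N))"
  have "(\<lambda>k::nat. exp (- c * real k) * (unit_ball_vol (real N) * (real k + 1) ^ N)) \<in> O(\<lambda>k. 1 / real k ^ 2)"
    using assms by real_asymp
  then have sa: "summable a"
    unfolding a_def by (rule summable_comparison_test_bigo[rotated]) (use inverse_power_summable[of 2, where 'a=real] in \<open>simp add: inverse_eq_divide\<close>)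
  have pos: "a k \<ge> 0" for k by (simp add: a_def)
  have "(\<integral>\<^sup>+ (x::'a). ennreal (norm (exp (- c * norm x))) \<partial>lborel)
      \<le> (\<integral>\<^sup>+ (x::'a). (\<Sum>k. ennreal (exp (- c * real k)) * indicator (cball 0 (real k + 1)) x) \<partial>lborel)"
  proof (rule nn_integral_mono)
    fix x :: 'a
    define k where "k = nat \<lfloor>norm x\<rfloor>"
    have k: "real k \<le> norm x" "norm x \<le> real k + 1" by (simp add: k_def) (unfold k_def, linarith)
    have "ennreal (norm (exp (- c * norm x))) \<le> ennreal (exp (- c * real k)) * indicator (cball 0 (real k + 1)) x"
      using k assms by (auto intro!: ennreal_leI)
    also have "\<dots> \<le> (\<Sum>k. ennreal (exp (- c * real k)) * indicator (cball 0 (real k + 1)) x)"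
      by (rule term_le_suminf)
    finally show "ennreal (norm (exp (- c * norm x)))
      \<le> (\<Sum>k. ennreal (exp (- c * real k)) * indicator (cball 0 (real k + 1)) x)" .
  qed
  also have "\<dots> = (\<Sum>k. ennreal (exp (- c * real k)) * emeasure lborel (cball (0::'a) (real k + 1)))"
    by (subst nn_integral_suminf)
      (auto simp: nn_integral_cmult_indicator intro!: borel_measurable_times_ennreal borel_measurable_indicator)
  also have "\<dots> = (\<Sum>k. ennreal (a k))"
    by (simp add: emeasure_cball a_def N_def ennreal_mult[symmetric])
  also have "\<dots> < \<infinity>" using sa pos by (simp add: suminf_ennreal2 less_top[symmetric])
  finally show "(\<integral>\<^sup>+ (x::'a). ennreal (norm (exp (- c * norm x))) \<partial>lborel) < \<infinity>" .
qed measurable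

lemma borel_measurable_lebesgue_on_continuous:
  assumes "continuous_on UNIV h"
  shows "h \<in> borel_measurable (lebesgue_on S)"
  using borel_measurable_continuous_onI[OF assms]
  by (intro measurable_restrict_space1 measurable_completion) simp

lemma norm_integral_le_integral:
  fixes f :: "'a \<Rightarrow> 'b::{banach, second_countable_topology}"
  assumes "integrable M f" "integrable M g" "\<And>x. x \<in> space M \<Longrightarrow> norm (f x) \<le> g x"
  shows "norm (integral\<^sup>L M f) \<le> integral\<^sup>L M g"
  by (rule order_trans[OF integral_norm_bound integral_mono]) (use assms in auto)

lemma integrable_exp_neg_norm:
  assumes "c > 0" "S \<in> sets lebesgue"
  shows "integrable (lebesgue_on S) (\<lambda>x::'a::euclidean_space. exp (- c * norm x))"
proof -
  have "integrable lebesgue (\<lambda>x::'a. exp (- c * norm x))"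
    using integrable_exp_neg_norm_lborel[OF assms(1)] by (simp add: integrable_completion)
  with assms(2) show ?thesis
    using integrable_mult_indicator[of S lebesgue "\<lambda>x::'a. exp (- c * norm x)"]
    by (simp add: integrable_restrict_space)
qed

text \<open>
  By inner regularity, the set where \<open>g\<close> is positive is exhausted up to a null set by compact sets.
  On such a compact set a positive function has integral zero, so the set is null.
\<close>
lemma AE_nonpos_of_compact_integrals:
  fixes g :: "'a::euclidean_space \<Rightarrow> real"
  assumes D: "D \<in> sets lebesgue" and g: "integrable (lebesgue_on D) g"
    and K: "\<And>K. compact K \<Longrightarrow> K \<subseteq> D \<Longrightarrow> (LINT x|lebesgue_on D. indicator K x * g x) = 0"
  shows "AE x in lebesgue_on D. g x \<le> 0"
proof -
  define A where "A = {x \<in> D. g x > 0}"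
  have "A \<in> sets (lebesgue_on D)" using borel_measurable_integrable[OF g]
    borel_measurable_less[of "\<lambda>_. 0" "lebesgue_on D" g] unfolding A_def by simp
  then have A: "A \<in> sets lebesgue" using D by (simp add: sets_restrict_space_iff)
  have null: "K \<in> null_sets lebesgue" if "compact K" "K \<subseteq> A" for K
  proof -
    have KD: "K \<subseteq> D" and KM: "K \<in> sets (lebesgue_on D)"
      using that D lmeasurable_compact[OF that(1)]
      by (auto simp: A_def sets_restrict_space_iff fmeasurable_def)
    have "AE x in lebesgue_on D. indicator K x * g x = 0"
      using integral_nonneg_eq_0_iff_AE[of "lebesgue_on D" "\<lambda>x. indicator K x * g x"] K[OF that(1) KD]
        integrable_mult_indicator[OF KM g] that(2)
      by (force simp: A_def indicator_def)
    then have "AE x in lebesgue_on D. x \<notin> K"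
      by (rule AE_mp) (use that(2) in \<open>auto simp: A_def indicator_def intro!: AE_I2\<close>)
    then have "K \<in> null_sets (lebesgue_on D)"
      using KM AE_iff_null_sets by blast
    then show ?thesis using D KD by (simp add: null_sets_restrict_space)
  qed
  have "A \<in> null_sets lebesgue"
  proof -
    have "\<exists>T. closed T \<and> T \<subseteq> A \<and> A - T \<in> lmeasurable \<and> emeasure lebesgue (A - T) < ennreal (inverse (real (Suc n)))" for n
      using sets_lebesgue_inner_closed[OF A, of "inverse (real (Suc n))"] by (metis inverse_positive_iff_positive of_nat_0_less_iff zero_less_Suc)
    then obtain T where T: "\<And>n. closed (T n)" "\<And>n. T n \<subseteq> A" "\<And>n. A - T n \<in> lmeasurable"
      "\<And>n::nat. emeasure lebesgue (A - T n) < ennreal (inverse (real (Suc n)))" by metis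
    \<comment> \<open>Closed sets are countable unions of compact sets.\<close>
    have TN: "T n \<in> null_sets lebesgue" for n
    proof -
      have "T n = (\<Union>k::nat. T n \<inter> cball 0 (real k))"
        by (auto simp: real_arch_simple)
      also have "\<dots> \<in> null_sets lebesgue"
        using T by (intro null_sets_UN null) (auto intro: closed_Int_compact)
      finally show ?thesis .
    qed
    have "emeasure lebesgue A \<le> ennreal (inverse (real (Suc n)))" for n
    proof -
      have "emeasure lebesgue A = emeasure lebesgue (A - T n)"
        using emeasure_Diff_null_set[OF TN A] by simp
      then show ?thesis using T(4)[of n] by simp
    qed
    moreover have "(\<lambda>n. ennreal (inverse (real (Suc n)))) \<longlonglongrightarrow> ennreal 0"
      by (intro tendsto_ennrealI LIMSEQ_inverse_real_of_nat)
    ultimately have "emeasure lebesgue A \<le> ennreal 0"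
      by (intro LIMSEQ_le_const) auto
    then show ?thesis using A by (simp add: null_setsI)
  qed
  then have "A \<in> null_sets (lebesgue_on D)" using D by (simp add: null_sets_restrict_space A_def)
  then show ?thesis by (rule AE_I') (auto simp: A_def)
qed

section \<open>Cones and their duals\<close>

lemma closed_dual_cone: "closed (dual_cone \<Omega>)"
proof -
  have "dual_cone \<Omega> = (\<Inter>x\<in>\<Omega>. {\<xi>. 0 \<le> x \<bullet> \<xi>})"
    by (auto simp: dual_cone_def)
  thus ?thesis by (auto intro!: closed_Collect_le continuous_intros)
qed

text \<open>
  An interior point \<open>y\<close> can be moved by \<open>c\<close> in the direction opposite to \<open>\<xi>\<close> without leaving \<open>\<Omega>\<close>;
  pairing the moved point with \<open>\<xi>\<close> still gives a nonnegative number. This lower bound is the source of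
  every exponential decay estimate below.
\<close>
lemma dual_cone_coercive:
  assumes "open \<Omega>" "y \<in> \<Omega>"
  obtains c where "c > 0" "\<And>\<xi>. \<xi> \<in> dual_cone \<Omega> \<Longrightarrow> c * norm \<xi> \<le> y \<bullet> \<xi>"
proof -
  obtain c where c: "c > 0" "cball y c \<subseteq> \<Omega>"
    using assms open_contains_cball by blast
  have "c * norm \<xi> \<le> y \<bullet> \<xi>" if "\<xi> \<in> dual_cone \<Omega>" for \<xi>
  proof (cases "\<xi> = 0")
    case False
    have "y - (c / norm \<xi>) *\<^sub>R \<xi> \<in> cball y c" using c False by (simp add: dist_norm)
    then have "0 \<le> (y - (c / norm \<xi>) *\<^sub>R \<xi>) \<bullet> \<xi>"
      using c(2) that unfolding dual_cone_def by blast
    then show ?thesis using False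
      by (simp add: inner_diff_left power2_norm_eq_inner[symmetric] power2_eq_square)
  qed simp
  with c show ?thesis using that by blast
qed

lemma cone_add_closed:
  assumes "open_pointed_cone \<Omega>" "x \<in> \<Omega>" "y \<in> \<Omega>"
  shows "x + y \<in> \<Omega>"
proof -
  have cone: "\<And>x t. x \<in> \<Omega> \<Longrightarrow> t > 0 \<Longrightarrow> t *\<^sub>R x \<in> \<Omega>" and "convex \<Omega>"
    using assms(1) by (auto simp: open_pointed_cone_def)
  then have "(1/2) *\<^sub>R x + (1/2) *\<^sub>R y \<in> \<Omega>"
    using assms by (intro convexD) auto
  from cone[OF this, of 2] show ?thesis by (simp add: scaleR_right_distrib)
qed

text \<open>
  A nonempty open set contains a basis. The candidates are \<open>y0 + \<delta> e\<^sub>j\<close> with a fixed \<open>y0\<close>; a vector orthogonal to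
  all of them has equal coordinates, and these vanish unless \<open>\<delta>\<close> equals minus the coordinate sum of \<open>y0\<close>.
\<close>
lemma open_set_contains_separating_vectors:
  fixes \<Omega> :: "(real ^ 'd) set"
  assumes "open \<Omega>" "\<Omega> \<noteq> {}"
  obtains Y :: "'d \<Rightarrow> real ^ 'd"
  where "\<And>j. Y j \<in> \<Omega>" "\<And>\<zeta>. (\<And>j. Y j \<bullet> \<zeta> = 0) \<Longrightarrow> \<zeta> = 0"
proof -
  obtain y0 e where e: "e > 0" "ball y0 e \<subseteq> \<Omega>"
    using assms by (metis ex_in_conv openE)
  define s where "s = (\<Sum>i\<in>UNIV. y0 $ i)"
  \<comment> \<open>Two small candidates, at most one of which can be the exceptional value.\<close>
  define \<delta> where "\<delta> = (if e/2 = - s then e/3 else e/2)"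
  have \<delta>: "0 < \<delta>" "\<delta> < e" "\<delta> + s \<noteq> 0" using e(1) by (auto simp: \<delta>_def)
  define Y where "Y j = y0 + \<delta> *\<^sub>R axis j 1" for j :: 'd
  have "Y j \<in> \<Omega>" for j using e \<delta> by (auto simp: Y_def dist_norm subset_eq)
  moreover have "\<zeta> = 0" if *: "\<And>j. Y j \<bullet> \<zeta> = 0" for \<zeta>
  proof -
    have j: "\<delta> * \<zeta> $ j = - (y0 \<bullet> \<zeta>)" for j
      using *[of j] by (simp add: Y_def inner_add_left inner_axis' )
    have "\<delta> * (y0 \<bullet> \<zeta>) = (\<Sum>i\<in>UNIV. y0 $ i * (\<delta> * \<zeta> $ i))"
      by (simp add: inner_vec_def sum_distrib_left mult_ac)
    also have "\<dots> = - (s * (y0 \<bullet> \<zeta>))"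
      unfolding j s_def by (simp add: sum_distrib_right sum_negf)
    finally have "(\<delta> + s) * (y0 \<bullet> \<zeta>) = 0" by (simp add: algebra_simps)
    with \<delta> j show ?thesis by (auto simp: vec_eq_iff)
  qed
  ultimately show ?thesis by (rule that)
qed

section \<open>The exponential kernel on the tube\<close>

lemma Im_bilin: "Im (bilin z \<xi>) = (\<chi> j. Im (z $ j)) \<bullet> \<xi>"
  by (simp add: bilin_def inner_vec_def)

lemma bilin_add: "bilin (z + w) \<xi> = bilin z \<xi> + bilin w \<xi>"
  by (simp add: bilin_def sum.distrib algebra_simps)

lemma bilin_smult: "bilin (c *s z) \<xi> = c * bilin z \<xi>"
  by (simp add: bilin_def sum_distrib_left algebra_simps)

lemma scaleR_eq_smult: "r *\<^sub>R z = complex_of_real r *s z" for z :: "complex ^ 'd"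
  by (simp add: vec_eq_iff) (simp add: scaleR_conv_of_real)

lemma continuous_bilin [continuous_intros]: "continuous_on S (\<lambda>\<xi>. bilin z \<xi>)"
  unfolding bilin_def by (intro continuous_intros)

lemma cmod_bilin_le: "cmod (bilin z \<xi>) \<le> norm z * norm \<xi>"
proof -
  have "cmod (bilin z \<xi>) \<le> (\<Sum>j\<in>UNIV. \<bar>norm (z $ j)\<bar> * \<bar>norm (\<xi> $ j)\<bar>)"
    unfolding bilin_def by (rule order_trans[OF norm_sum]) (simp add: norm_mult)
  also have "\<dots> \<le> norm z * norm \<xi>"
    unfolding norm_vec_def by (rule L2_set_mult_ineq)
  finally show ?thesis .
qed

lemma open_tube: "open \<Omega> \<Longrightarrow> open (tube \<Omega>)"
  unfolding tube_def
  using open_vimage[of \<Omega> "\<lambda>z::complex^_. (\<chi> j. Im (z $ j))"]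
  by (simp add: vimage_def continuous_intros)

lemma cmod_laplace_kernel: "cmod (exp (\<i> * bilin z \<xi>)) = exp (- ((\<chi> j. Im (z $ j)) \<bullet> \<xi>))"
  by (simp add: Im_bilin)

lemma laplace_kernel_decay:
  assumes "open \<Omega>" "z \<in> tube \<Omega>"
  obtains c where "c > 0"
    "\<And>\<xi>. \<xi> \<in> dual_cone \<Omega> \<Longrightarrow> cmod (exp (\<i> * bilin z \<xi>)) \<le> exp (- c * norm \<xi>)"
proof -
  obtain c where "c > 0"
    "\<And>\<xi>. \<xi> \<in> dual_cone \<Omega> \<Longrightarrow> c * norm \<xi> \<le> (\<chi> j. Im (z $ j)) \<bullet> \<xi>"
    using dual_cone_coercive[of \<Omega> "\<chi> j. Im (z $ j)"] assms by (auto simp: tube_def)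
  then show ?thesis using that unfolding cmod_laplace_kernel by auto
qed

section \<open>Holomorphy of Laplace transforms\<close>

text \<open>
  Every positive \<open>c\<close> is demanded because the decay rate of the kernel tends to zero towards the boundary of the
  tube. This is the common integrability condition for densities in the weighted \<open>L\<^sup>2\<close> space and for their
  differences; it makes the Laplace integral converge absolutely on the tube.
\<close>
definition exp_tempered :: "(real ^ 'd) set \<Rightarrow> (real ^ 'd \<Rightarrow> complex) \<Rightarrow> bool" where
  "exp_tempered S f \<longleftrightarrow> f \<in> borel_measurable (lebesgue_on S) \<and>
     (\<forall>c>0. integrable (lebesgue_on S) (\<lambda>\<xi>. exp (- c * norm \<xi>) * cmod (f \<xi>)))"

lemma exp_tempered_measurable: "exp_tempered S f \<Longrightarrow> f \<in> borel_measurable (lebesgue_on S)"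
  by (simp add: exp_tempered_def)

lemma exp_tempered_integrable:
  assumes "exp_tempered S f" "c > 0" "h \<in> borel_measurable (lebesgue_on S)"
    and "\<And>\<xi>. \<xi> \<in> S \<Longrightarrow> cmod (h \<xi>) \<le> B * exp (- c * norm \<xi>)"
  shows "integrable (lebesgue_on S) (\<lambda>\<xi>. h \<xi> * f \<xi>)"
proof (rule Bochner_Integration.integrable_bound)
  show "integrable (lebesgue_on S) (\<lambda>\<xi>. B * (exp (- c * norm \<xi>) * cmod (f \<xi>)))"
    using assms(1,2) by (simp add: exp_tempered_def)
  show "(\<lambda>\<xi>. h \<xi> * f \<xi>) \<in> borel_measurable (lebesgue_on S)"
    using assms(3) exp_tempered_measurable[OF assms(1)] by simp
  show "AE \<xi> in lebesgue_on S. norm (h \<xi> * f \<xi>) \<le> norm (B * (exp (- c * norm \<xi>) * cmod (f \<xi>)))"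
  proof (rule AE_I2)
    fix \<xi> assume "\<xi> \<in> space (lebesgue_on S)"
    then have "cmod (h \<xi>) * cmod (f \<xi>) \<le> B * exp (- c * norm \<xi>) * cmod (f \<xi>)"
      using assms(4) by (intro mult_right_mono) auto
    then show "norm (h \<xi> * f \<xi>) \<le> norm (B * (exp (- c * norm \<xi>) * cmod (f \<xi>)))"
      by (simp add: norm_mult mult.assoc)
  qed
qed

lemma exp_tempered_diff:
  assumes "exp_tempered S f" "exp_tempered S g"
  shows "exp_tempered S (\<lambda>\<xi>. f \<xi> - g \<xi>)"
  unfolding exp_tempered_def
proof (intro conjI allI impI)
  show m: "(\<lambda>\<xi>. f \<xi> - g \<xi>) \<in> borel_measurable (lebesgue_on S)"
    using assms[THEN exp_tempered_measurable] by simp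
  fix c :: real assume "c > 0"
  then have "integrable (lebesgue_on S)
      (\<lambda>\<xi>. exp (- c * norm \<xi>) * cmod (f \<xi>) + exp (- c * norm \<xi>) * cmod (g \<xi>))"
    using assms by (intro Bochner_Integration.integrable_add) (auto simp: exp_tempered_def)
  moreover have "(\<lambda>\<xi>. exp (- c * norm \<xi>) * cmod (f \<xi> - g \<xi>)) \<in> borel_measurable (lebesgue_on S)"
    by (intro borel_measurable_times borel_measurable_lebesgue_on_continuous
        measurable_compose[OF m borel_measurable_norm] continuous_intros)
  ultimately show "integrable (lebesgue_on S) (\<lambda>\<xi>. exp (- c * norm \<xi>) * cmod (f \<xi> - g \<xi>))"
    by (rule Bochner_Integration.integrable_bound)
      (auto intro!: AE_I2 simp: abs_mult norm_triangle_ineq4 simp flip: distrib_left)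
qed

text \<open>
  The candidate derivative is obtained by differentiating under the integral. By the second-order Taylor
  estimate for the exponential, the remainder of the integrand at increment \<open>h\<close> is bounded by \<open>(norm h)\<^sup>2\<close> times
  \<open>(norm \<xi>)\<^sup>2 * exp (- (c/2) * norm \<xi>) * cmod (f \<xi>)\<close> as long as \<open>norm h \<le> c/2\<close>. Half of the remaining exponent
  absorbs the factor \<open>(norm \<xi>)\<^sup>2\<close>, so the remainder of the transform is \<open>O((norm h)\<^sup>2)\<close>.
\<close>
lemma holomorphic_several_laplace:
  fixes \<Omega> :: "(real ^ 'd) set"
  assumes "open \<Omega>" and f: "exp_tempered (dual_cone \<Omega>) f"
  shows "holomorphic_several (laplace \<Omega> f) (tube \<Omega>)"
  unfolding holomorphic_several_def
proof
  let ?M = "lebesgue_on (dual_cone \<Omega>)"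
  fix z assume "z \<in> tube \<Omega>"
  then obtain c where c: "c > 0"
    and decay: "\<And>\<xi>. \<xi> \<in> dual_cone \<Omega> \<Longrightarrow> cmod (exp (\<i> * bilin z \<xi>)) \<le> exp (- c * norm \<xi>)"
    using laplace_kernel_decay assms(1) by blast
  define m where "m = (LINT \<xi>|?M. exp (- (c/4) * norm \<xi>) * cmod (f \<xi>))"
  define D where "D h = (LINT \<xi>|?M. \<i> * bilin h \<xi> * exp (\<i> * bilin z \<xi>) * f \<xi>)" for h
  have Ibase: "integrable ?M (\<lambda>\<xi>. exp (- (c/4) * norm \<xi>) * cmod (f \<xi>))"
    using f c unfolding exp_tempered_def by (meson divide_pos_pos zero_less_numeral)
  have lin_bd: "norm \<xi> * exp (- c * norm \<xi>) \<le> (4/c) * exp (- (c/4) * norm \<xi>)" for \<xi> :: "real^'d"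
  proof -
    have "(c/4) * norm \<xi> \<le> exp ((c/4) * norm \<xi>)"
      using exp_ge_add_one_self[of "(c/4) * norm \<xi>"] by linarith
    also have "\<dots> \<le> exp ((3*c/4) * norm \<xi>)" using c by (simp add: mult_right_mono)
    finally have "norm \<xi> \<le> (4/c) * exp ((3*c/4) * norm \<xi>)" using c by (simp add: field_simps)
    then have "norm \<xi> * exp (- c * norm \<xi>) \<le> (4/c) * exp ((3*c/4) * norm \<xi>) * exp (- c * norm \<xi>)"
      by (rule mult_right_mono) simp
    also have "\<dots> = (4/c) * exp (- (c/4) * norm \<xi>)"
      by (simp add: mult.assoc exp_add[symmetric])
    finally show ?thesis .
  qed
  have D_bd: "cmod (\<i> * bilin h \<xi> * exp (\<i> * bilin z \<xi>)) \<le> (norm h * (4/c)) * exp (- (c/4) * norm \<xi>)"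
    if "\<xi> \<in> dual_cone \<Omega>" for h \<xi>
  proof -
    have "cmod (\<i> * bilin h \<xi> * exp (\<i> * bilin z \<xi>)) \<le> (norm h * norm \<xi>) * exp (- c * norm \<xi>)"
      using mult_mono[OF cmod_bilin_le decay[OF that], of h \<xi>] by (simp add: norm_mult)
    also have "\<dots> \<le> norm h * ((4/c) * exp (- (c/4) * norm \<xi>))"
      unfolding mult.assoc by (rule mult_left_mono[OF lin_bd]) simp
    finally show ?thesis by simp
  qed
  have ID: "integrable ?M (\<lambda>\<xi>. \<i> * bilin h \<xi> * exp (\<i> * bilin z \<xi>) * f \<xi>)" for h
    using c by (intro exp_tempered_integrable[OF f _ _ D_bd]
        borel_measurable_lebesgue_on_continuous continuous_intros) auto
  have IL: "integrable ?M (\<lambda>\<xi>. exp (\<i> * bilin (z + h) \<xi>) * f \<xi>)" if "norm h \<le> c/2" for h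
  proof (rule exp_tempered_integrable[OF f, of "c/2" _ 1])
    fix \<xi> assume \<xi>: "\<xi> \<in> dual_cone \<Omega>"
    have "cmod (exp (\<i> * bilin h \<xi>)) \<le> exp (c/2 * norm \<xi>)"
      using cmod_bilin_le[of h \<xi>] mult_right_mono[OF that, of "norm \<xi>"] abs_Im_le_cmod[of "bilin h \<xi>"]
      by simp
    then have "cmod (exp (\<i> * bilin (z + h) \<xi>)) \<le> exp (- c * norm \<xi>) * exp (c/2 * norm \<xi>)"
      using mult_mono[OF decay[OF \<xi>]] by (simp add: bilin_add distrib_left exp_add norm_mult)
    then show "cmod (exp (\<i> * bilin (z + h) \<xi>)) \<le> 1 * exp (- (c/2) * norm \<xi>)"
      by (simp add: exp_add[symmetric])
  qed (use c in \<open>auto intro!: borel_measurable_lebesgue_on_continuous continuous_intros\<close>)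
  have rem: "cmod (laplace \<Omega> f (z + h) - laplace \<Omega> f z - D h) \<le> (norm h)\<^sup>2 * (32 / c\<^sup>2 * m)"
    if h: "norm h \<le> c/2" for h
  proof -
    have "laplace \<Omega> f (z + h) - laplace \<Omega> f z - D h =
        (LINT \<xi>|?M. exp (\<i> * bilin (z + h) \<xi>) * f \<xi> - exp (\<i> * bilin z \<xi>) * f \<xi>
            - \<i> * bilin h \<xi> * exp (\<i> * bilin z \<xi>) * f \<xi>)"
      unfolding laplace_def D_def using IL[OF h] IL[of 0] ID c by simp
    also have "cmod \<dots> \<le> (LINT \<xi>|?M. (norm h)\<^sup>2 * (32 / c\<^sup>2) * (exp (- (c/4) * norm \<xi>) * cmod (f \<xi>)))"
    proof (rule norm_integral_le_integral)
      fix \<xi> assume "\<xi> \<in> space ?M"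
      then have \<xi>: "\<xi> \<in> dual_cone \<Omega>" by simp
      define u where "u = \<i> * bilin h \<xi>"
      have u: "cmod u \<le> norm h * norm \<xi>" "\<bar>Re u\<bar> \<le> c/2 * norm \<xi>"
        using cmod_bilin_le[of h \<xi>] mult_right_mono[OF h, of "norm \<xi>"] abs_Re_le_cmod[of u]
        by (auto simp: u_def norm_mult)
      have "cmod (exp u - (\<Sum>k\<le>1. u ^ k / fact k)) \<le> exp \<bar>Re u\<bar> * (cmod u ^ Suc 1) / fact 1"
        by (rule Taylor_exp)
      then have "cmod (exp u - 1 - u) \<le> exp \<bar>Re u\<bar> * (cmod u)\<^sup>2"
        by (simp add: power2_eq_square diff_diff_eq)
      also have "\<dots> \<le> exp (c/2 * norm \<xi>) * (norm h * norm \<xi>)\<^sup>2"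
        using u by (intro mult_mono power_mono) auto
      finally have t: "cmod (exp u - 1 - u) \<le> exp (c/2 * norm \<xi>) * (norm h * norm \<xi>)\<^sup>2" .
      have q: "(norm \<xi>)\<^sup>2 \<le> 32 / c\<^sup>2 * exp (c/4 * norm \<xi>)"
      proof -
        have "0 \<le> c/4 * norm \<xi>" using c by simp
        then have "(c/4 * norm \<xi>)\<^sup>2 / 2 \<le> exp (c/4 * norm \<xi>)"
          using exp_lower_Taylor_quadratic[of "c/4 * norm \<xi>"] by linarith
        then show ?thesis using c by (simp add: field_simps power2_eq_square)
      qed
      have "cmod (exp (\<i> * bilin (z + h) \<xi>) * f \<xi> - exp (\<i> * bilin z \<xi>) * f \<xi>
            - \<i> * bilin h \<xi> * exp (\<i> * bilin z \<xi>) * f \<xi>)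
          = cmod (exp (\<i> * bilin z \<xi>) * (exp u - 1 - u) * f \<xi>)"
        by (simp add: u_def bilin_add distrib_left exp_add algebra_simps)
      also have "\<dots> = cmod (exp (\<i> * bilin z \<xi>)) * cmod (exp u - 1 - u) * cmod (f \<xi>)"
        by (simp only: norm_mult)
      also have "\<dots> \<le> exp (- c * norm \<xi>) * (exp (c/2 * norm \<xi>) * (norm h * norm \<xi>)\<^sup>2) * cmod (f \<xi>)"
        using decay[OF \<xi>] t by (intro mult_mono) auto
      also have "\<dots> = (exp (- c * norm \<xi>) * exp (c/2 * norm \<xi>) * (norm h)\<^sup>2 * cmod (f \<xi>)) * (norm \<xi>)\<^sup>2"
        by (simp add: power_mult_distrib)
      also have "\<dots> \<le> (exp (- c * norm \<xi>) * exp (c/2 * norm \<xi>) * (norm h)\<^sup>2 * cmod (f \<xi>)) *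
          (32 / c\<^sup>2 * exp (c/4 * norm \<xi>))"
        by (rule mult_left_mono[OF q]) simp
      also have "\<dots> = (norm h)\<^sup>2 * (32 / c\<^sup>2) *
          ((exp (- c * norm \<xi>) * exp (c/2 * norm \<xi>) * exp (c/4 * norm \<xi>)) * cmod (f \<xi>))"
        by simp
      also have "exp (- c * norm \<xi>) * exp (c/2 * norm \<xi>) * exp (c/4 * norm \<xi>) = exp (- (c/4) * norm \<xi>)"
        by (simp add: exp_add[symmetric])
      finally show "cmod (exp (\<i> * bilin (z + h) \<xi>) * f \<xi> - exp (\<i> * bilin z \<xi>) * f \<xi>
            - \<i> * bilin h \<xi> * exp (\<i> * bilin z \<xi>) * f \<xi>)
          \<le> (norm h)\<^sup>2 * (32 / c\<^sup>2) * (exp (- (c/4) * norm \<xi>) * cmod (f \<xi>))" .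
    qed (use IL[OF h] IL[of 0] ID Ibase c in auto)
    also have "\<dots> = (norm h)\<^sup>2 * (32 / c\<^sup>2 * m)" unfolding m_def by simp
    finally show ?thesis .
  qed
  have D_smult: "D (a *s v) = a * D v" for a v
  proof -
    have "D (a *s v) = (LINT \<xi>|?M. a * (\<i> * bilin v \<xi> * exp (\<i> * bilin z \<xi>) * f \<xi>))"
      unfolding D_def bilin_smult by (simp add: mult_ac)
    then show ?thesis by (simp add: D_def)
  qed
  have "bounded_linear D"
  proof (rule bounded_linear_intro)
    show "D (v + w) = D v + D w" for v w
      unfolding D_def bilin_add using ID by (simp add: distrib_left distrib_right)
    show "D (r *\<^sub>R v) = r *\<^sub>R D v" for r v
      by (simp add: scaleR_eq_smult D_smult scaleR_conv_of_real)
    show "norm (D v) \<le> norm v * (4 / c * m)" for v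
    proof -
      have "norm (D v) \<le> (LINT \<xi>|?M. norm v * (4/c) * (exp (- (c/4) * norm \<xi>) * cmod (f \<xi>)))"
        unfolding D_def
      proof (rule norm_integral_le_integral)
        fix \<xi> assume "\<xi> \<in> space ?M"
        then have "cmod (\<i> * bilin v \<xi> * exp (\<i> * bilin z \<xi>)) * cmod (f \<xi>)
            \<le> ((norm v * (4/c)) * exp (- (c/4) * norm \<xi>)) * cmod (f \<xi>)"
          by (intro mult_right_mono D_bd) auto
        then show "cmod (\<i> * bilin v \<xi> * exp (\<i> * bilin z \<xi>) * f \<xi>)
            \<le> norm v * (4/c) * (exp (- (c/4) * norm \<xi>) * cmod (f \<xi>))"
          by (simp add: norm_mult mult_ac)
      qed (use ID Ibase in auto)
      then show ?thesis by (simp add: m_def)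
    qed
  qed
  moreover have "(\<lambda>h. norm (laplace \<Omega> f (z + h) - laplace \<Omega> f z - D h) / norm h) \<midarrow>0\<rightarrow> 0"
  proof (rule Lim_null_comparison)
    show "((\<lambda>h::complex^'d. norm h * (32 / c\<^sup>2 * m)) \<longlongrightarrow> 0) (at 0)"
      by (rule tendsto_eq_intros refl | simp)+
    have "\<forall>\<^sub>F h::complex^'d in at 0. dist h 0 < c/2"
      using c by (auto simp: eventually_at intro!: exI[of _ "c/2"])
    then show "\<forall>\<^sub>F h in at 0. norm (norm (laplace \<Omega> f (z + h) - laplace \<Omega> f z - D h) / norm h)
        \<le> norm h * (32 / c\<^sup>2 * m)"
    proof (rule eventually_mono)
      fix h :: "complex^'d" assume "dist h 0 < c/2"
      then show "norm (norm (laplace \<Omega> f (z + h) - laplace \<Omega> f z - D h) / norm h)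
        \<le> norm h * (32 / c\<^sup>2 * m)"
        using divide_right_mono[OF rem[of h], of "norm h"]
        by (cases "h = 0") (auto simp: power2_eq_square)
    qed
  qed
  ultimately have "(laplace \<Omega> f has_derivative D) (at z)"
    by (simp add: has_derivative_at)
  with D_smult show "\<exists>D. (laplace \<Omega> f has_derivative D) (at z) \<and> (\<forall>c v. D (c *s v) = c * D v)"
    by blast
qed

section \<open>Injectivity of the Laplace transform\<close>

lemma exp_tempered_integrable_exp:
  assumes "open \<Omega>" "exp_tempered (dual_cone \<Omega>) f" "m \<in> \<Omega>"
    "h \<in> borel_measurable (lebesgue_on (dual_cone \<Omega>))" "\<And>\<xi>. \<xi> \<in> dual_cone \<Omega> \<Longrightarrow> \<bar>h \<xi>\<bar> \<le> B"
  shows "integrable (lebesgue_on (dual_cone \<Omega>)) (\<lambda>\<xi>. complex_of_real (h \<xi> * exp (- (m \<bullet> \<xi>))) * f \<xi>)"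
proof -
  obtain c where c: "c > 0" "\<And>\<xi>. \<xi> \<in> dual_cone \<Omega> \<Longrightarrow> c * norm \<xi> \<le> m \<bullet> \<xi>"
    using dual_cone_coercive assms(1,3) by blast
  show ?thesis
  proof (rule exp_tempered_integrable[OF assms(2) c(1), where B=B])
    have "(\<lambda>\<xi>. exp (- (m \<bullet> \<xi>))) \<in> borel_measurable (lebesgue_on (dual_cone \<Omega>))"
      by (intro borel_measurable_lebesgue_on_continuous continuous_intros)
    with assms(4) show "(\<lambda>\<xi>. complex_of_real (h \<xi> * exp (- (m \<bullet> \<xi>)))) \<in> borel_measurable (lebesgue_on (dual_cone \<Omega>))"
      by measurable
    fix \<xi> assume \<xi>: "\<xi> \<in> dual_cone \<Omega>"
    then have "\<bar>h \<xi>\<bar> * exp (- (m \<bullet> \<xi>)) \<le> B * exp (- c * norm \<xi>)"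
      using c(2)[OF \<xi>] assms(5)[OF \<xi>] by (intro mult_mono) auto
    then show "cmod (complex_of_real (h \<xi> * exp (- (m \<bullet> \<xi>)))) \<le> B * exp (- c * norm \<xi>)"
      by (simp add: norm_mult abs_mult del: of_real_mult)
  qed
qed

lemma laplace_imaginary:
  fixes m :: "real ^ 'd"
  shows "laplace \<Omega> f (\<chi> j. \<i> * complex_of_real (m $ j))
    = (LINT \<xi>|lebesgue_on (dual_cone \<Omega>). complex_of_real (exp (- (m \<bullet> \<xi>))) * f \<xi>)"
proof -
  have "bilin (\<chi> j. \<i> * complex_of_real (m $ j)) \<xi> = \<i> * complex_of_real (m \<bullet> \<xi>)" for \<xi>
    by (simp add: bilin_def inner_vec_def sum_distrib_left mult.assoc)
  then have "\<i> * bilin (\<chi> j. \<i> * complex_of_real (m $ j)) \<xi> = complex_of_real (- (m \<bullet> \<xi>))" for \<xi>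
    by (simp add: mult.assoc[symmetric])
  then show ?thesis unfolding laplace_def by (simp only: exp_of_real)
qed

text \<open>
  Exponentials \<open>exp (- (y \<bullet> \<xi>))\<close> with \<open>y\<close> in the cone are closed under multiplication because the cone is
  closed under addition, so all polynomials in them are annihilated by \<open>f\<close>. The extra factor
  \<open>exp (- (m \<bullet> \<xi>))\<close> provides integrability, also for the constant polynomial.
\<close>
lemma polynomial_of_exponentials_annihilates:
  fixes \<Omega> :: "(real ^ 'd) set" and Y :: "'d \<Rightarrow> real ^ 'd"
  assumes \<Omega>: "open_pointed_cone \<Omega>" and f: "exp_tempered (dual_cone \<Omega>) f"
    and zero: "\<And>z. z \<in> tube \<Omega> \<Longrightarrow> laplace \<Omega> f z = 0"
    and Y: "\<And>j. Y j \<in> \<Omega>" and p: "real_polynomial_function p" and m: "m \<in> \<Omega>"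
  shows "(LINT \<xi>|lebesgue_on (dual_cone \<Omega>).
     complex_of_real (p (\<chi> j. exp (- (Y j \<bullet> \<xi>))) * exp (- (m \<bullet> \<xi>))) * f \<xi>) = 0"
proof -
  let ?M = "lebesgue_on (dual_cone \<Omega>)"
  define U where "U = (\<lambda>\<xi>. \<chi> j. exp (- (Y j \<bullet> \<xi>)))"
  define I where "I h m = (LINT \<xi>|?M. complex_of_real (h \<xi> * exp (- (m \<bullet> \<xi>))) * f \<xi>)" for h m
  \<comment> \<open>The bounded functions annihilated in this sense. Induction over polynomials does not work for
    membership in \<open>W\<close>, as \<open>W\<close> need not be closed under products. What is inherited by sums and products is the
    property of mapping \<open>W\<close> into itself by multiplication.\<close>
  define W where "W = {h \<in> borel_measurable ?M. (\<exists>B. \<forall>\<xi>\<in>dual_cone \<Omega>. \<bar>h \<xi>\<bar> \<le> B) \<and> (\<forall>m\<in>\<Omega>. I h m = 0)}"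
  have "open \<Omega>" using \<Omega> by (simp add: open_pointed_cone_def)
  have int: "integrable ?M (\<lambda>\<xi>. complex_of_real (h \<xi> * exp (- (m \<bullet> \<xi>))) * f \<xi>)"
    if h: "h \<in> W" and m: "m \<in> \<Omega>" for h m
  proof -
    obtain B where "\<forall>\<xi>\<in>dual_cone \<Omega>. \<bar>h \<xi>\<bar> \<le> B" "h \<in> borel_measurable ?M"
      using h by (auto simp: W_def)
    then show ?thesis
      by (intro exp_tempered_integrable_exp[OF \<open>open \<Omega>\<close> f m, of h B]) auto
  qed
  have W_add: "(\<lambda>\<xi>. h \<xi> + k \<xi>) \<in> W" if hk: "h \<in> W" "k \<in> W" for h k
  proof -
    have "I (\<lambda>\<xi>. h \<xi> + k \<xi>) m = I h m + I k m" if "m \<in> \<Omega>" for m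
      unfolding I_def using int[OF \<open>h \<in> W\<close> that] int[OF \<open>k \<in> W\<close> that]
      by (simp add: distrib_right flip: Bochner_Integration.integral_add)
    moreover have "\<exists>B. \<forall>\<xi>\<in>dual_cone \<Omega>. \<bar>h \<xi> + k \<xi>\<bar> \<le> B"
    proof -
      obtain A B where "\<forall>\<xi>\<in>dual_cone \<Omega>. \<bar>h \<xi>\<bar> \<le> A" "\<forall>\<xi>\<in>dual_cone \<Omega>. \<bar>k \<xi>\<bar> \<le> B"
        using hk by (auto simp: W_def)
      then have "\<forall>\<xi>\<in>dual_cone \<Omega>. \<bar>h \<xi> + k \<xi>\<bar> \<le> A + B"
        by (meson abs_triangle_ineq add_mono order_trans)
      then show ?thesis ..
    qed
    ultimately show ?thesis using hk unfolding W_def by auto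
  qed
  have W_cmult: "(\<lambda>\<xi>. c * h \<xi>) \<in> W" if h: "h \<in> W" for c h
  proof -
    have "I (\<lambda>\<xi>. c * h \<xi>) m = complex_of_real c * I h m" for m
      unfolding I_def by (simp add: mult.assoc)
    moreover obtain B where "\<forall>\<xi>\<in>dual_cone \<Omega>. \<bar>h \<xi>\<bar> \<le> B"
      using h by (auto simp: W_def)
    then have "\<forall>\<xi>\<in>dual_cone \<Omega>. \<bar>c * h \<xi>\<bar> \<le> \<bar>c\<bar> * B"
      by (simp add: abs_mult mult_left_mono)
    ultimately show ?thesis using h by (auto simp: W_def)
  qed
  have W_sum: "(\<lambda>\<xi>. \<Sum>j\<in>A. h j \<xi>) \<in> W" if "finite A" "\<And>j. h j \<in> W" for A :: "'d set" and h
    using that(1)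
  proof induction
    case empty
    show ?case by (auto simp: W_def I_def)
  next
    case (insert j A)
    then show ?case using W_add[OF that(2)[of j]] by simp
  qed
  \<comment> \<open>Multiplication by \<open>exp (- (y \<bullet> \<xi>))\<close> only shifts \<open>m\<close> to \<open>m + y\<close>.\<close>
  have W_exp: "(\<lambda>\<xi>. exp (- (y \<bullet> \<xi>)) * h \<xi>) \<in> W" if h: "h \<in> W" and y: "y \<in> \<Omega>" for y h
  proof -
    have "I (\<lambda>\<xi>. exp (- (y \<bullet> \<xi>)) * h \<xi>) m = I h (m + y)" for m
      unfolding I_def by (simp add: inner_add_left exp_add exp_diff exp_minus field_simps)
    then have "\<forall>m\<in>\<Omega>. I (\<lambda>\<xi>. exp (- (y \<bullet> \<xi>)) * h \<xi>) m = 0"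
      using h y cone_add_closed[OF \<Omega>] by (auto simp: W_def)
    moreover obtain B where B: "\<And>\<xi>. \<xi> \<in> dual_cone \<Omega> \<Longrightarrow> \<bar>h \<xi>\<bar> \<le> B"
      using h by (auto simp: W_def)
    have "\<bar>exp (- (y \<bullet> \<xi>)) * h \<xi>\<bar> \<le> B" if \<xi>: "\<xi> \<in> dual_cone \<Omega>" for \<xi>
    proof -
      have "exp (- (y \<bullet> \<xi>)) \<le> 1" using \<xi> y by (auto simp: dual_cone_def)
      then have "exp (- (y \<bullet> \<xi>)) * \<bar>h \<xi>\<bar> \<le> 1 * B"
        using B[OF \<xi>] by (intro mult_mono) auto
      then show ?thesis by (simp add: abs_mult)
    qed
    moreover have "(\<lambda>\<xi>. exp (- (y \<bullet> \<xi>))) \<in> borel_measurable ?M"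
      by (intro borel_measurable_lebesgue_on_continuous continuous_intros)
    ultimately show ?thesis using h unfolding W_def by auto
  qed
  have mult_p: "(\<lambda>\<xi>. p (U \<xi>) * h \<xi>) \<in> W" if "h \<in> W" for h
    using p that
  proof (induction arbitrary: h rule: real_polynomial_function.induct)
    case (linear l)
    have "l (U \<xi>) * h \<xi> = (\<Sum>j\<in>UNIV. l (axis j 1) * (exp (- (Y j \<bullet> \<xi>)) * h \<xi>))" for \<xi>
    proof -
      have "U \<xi> = (\<Sum>j\<in>UNIV. exp (- (Y j \<bullet> \<xi>)) *\<^sub>R axis j 1)"
        by (simp add: U_def vec_eq_iff axis_def if_distrib cong: if_cong)
      then have "l (U \<xi>) = (\<Sum>j\<in>UNIV. exp (- (Y j \<bullet> \<xi>)) * l (axis j 1))"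
        using linear(1) by (simp add: bounded_linear.linear linear_sum linear_cmul)
      then show ?thesis by (simp add: sum_distrib_left sum_distrib_right mult_ac)
    qed
    then show ?case using linear(2) by (simp add: W_sum W_cmult W_exp Y)
  next
    case (const c)
    then show ?case by (rule W_cmult)
  next
    case (add p q)
    then show ?case using W_add by (simp add: distrib_right)
  next
    case (mult p q)
    then show ?case by (simp add: mult.assoc)
  qed
  have "I (\<lambda>_. 1) m = 0" if "m \<in> \<Omega>" for m
    using zero[of "\<chi> j. \<i> * complex_of_real (m $ j)"] that
    by (simp add: laplace_imaginary I_def tube_def)
  then have "(\<lambda>_. 1) \<in> W" by (auto simp: W_def)
  from mult_p[OF this] m show ?thesis by (auto simp: W_def I_def U_def)
qed

text \<open>
  The vector of exponentials takes values in the unit cube, which is compact even though the dual cone is not;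
  there the Stone--Weierstrass theorem passes from polynomials to continuous functions.
\<close>
lemma continuous_of_exponentials_annihilates:
  fixes \<Omega> :: "(real ^ 'd) set" and Y :: "'d \<Rightarrow> real ^ 'd"
  assumes \<Omega>: "open_pointed_cone \<Omega>" and f: "exp_tempered (dual_cone \<Omega>) f"
    and zero: "\<And>z. z \<in> tube \<Omega> \<Longrightarrow> laplace \<Omega> f z = 0"
    and Y: "\<And>j. Y j \<in> \<Omega>" and \<phi>: "continuous_on UNIV \<phi>" and m: "m \<in> \<Omega>"
  shows "(LINT \<xi>|lebesgue_on (dual_cone \<Omega>).
     complex_of_real (\<phi> (\<chi> j. exp (- (Y j \<bullet> \<xi>))) * exp (- (m \<bullet> \<xi>))) * f \<xi>) = 0"
proof -
  let ?M = "lebesgue_on (dual_cone \<Omega>)"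
  let ?Q = "cbox 0 1 :: (real ^ 'd) set"
  define U where "U = (\<lambda>\<xi>. \<chi> j. exp (- (Y j \<bullet> \<xi>)))"
  define E where "E = (\<lambda>\<xi>. complex_of_real (exp (- (m \<bullet> \<xi>))) * f \<xi>)"
  have "open \<Omega>" using \<Omega> by (simp add: open_pointed_cone_def)
  have UQ: "U \<xi> \<in> ?Q" if "\<xi> \<in> dual_cone \<Omega>" for \<xi>
    using that Y by (auto simp: mem_box_cart U_def dual_cone_def)
  have contU: "continuous_on UNIV U" unfolding U_def by (intro continuous_intros)
  have int: "integrable ?M (\<lambda>\<xi>. complex_of_real (\<psi> (U \<xi>)) * E \<xi>)"
    if \<psi>: "continuous_on UNIV \<psi>" for \<psi> :: "real ^ 'd \<Rightarrow> real"
  proof -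
    have "bounded (\<psi> ` ?Q)"
      by (intro compact_imp_bounded compact_continuous_image) (use \<psi> continuous_on_subset in auto)
    then obtain B where "\<And>x. x \<in> ?Q \<Longrightarrow> \<bar>\<psi> x\<bar> \<le> B" by (auto simp: bounded_iff)
    moreover have "(\<lambda>\<xi>. \<psi> (U \<xi>)) \<in> borel_measurable ?M"
      by (intro borel_measurable_lebesgue_on_continuous continuous_on_compose2[OF \<psi> contU]) auto
    ultimately show ?thesis
      using exp_tempered_integrable_exp[OF \<open>open \<Omega>\<close> f m, of "\<lambda>\<xi>. \<psi> (U \<xi>)" B] UQ
      by (simp add: E_def mult.assoc)
  qed
  have intE: "integrable ?M (\<lambda>\<xi>. cmod (E \<xi>))"
    using integrable_norm[OF int[of "\<lambda>_. 1"]] by simp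
  define L where "L = (LINT \<xi>|?M. complex_of_real (\<phi> (U \<xi>)) * E \<xi>)"
  define N where "N = (LINT \<xi>|?M. cmod (E \<xi>))"
  have "N \<ge> 0" unfolding N_def by simp
  have "cmod L \<le> e * N" if e: "e > 0" for e
  proof -
    obtain p where p: "real_polynomial_function p" "\<And>x. x \<in> ?Q \<Longrightarrow> \<bar>\<phi> x - p x\<bar> < e"
      using Stone_Weierstrass_real_polynomial_function[OF compact_cbox continuous_on_subset[OF \<phi>] e]
      by blast
    have contp: "continuous_on UNIV p"
      using p(1) by (simp add: continuous_on_polymonial_function real_polynomial_function_eq)
    have "(LINT \<xi>|?M. complex_of_real (p (U \<xi>)) * E \<xi>) = 0"
      using polynomial_of_exponentials_annihilates[where Y=Y, OF \<Omega> f zero Y p(1) m]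
      by (simp add: E_def U_def mult.assoc)
    then have "L = (LINT \<xi>|?M. complex_of_real (\<phi> (U \<xi>)) * E \<xi> - complex_of_real (p (U \<xi>)) * E \<xi>)"
      using int[OF \<phi>] int[OF contp] by (simp add: L_def)
    also have "cmod \<dots> \<le> (LINT \<xi>|?M. e * cmod (E \<xi>))"
    proof (rule norm_integral_le_integral)
      fix \<xi> assume "\<xi> \<in> space ?M"
      then have "\<bar>\<phi> (U \<xi>) - p (U \<xi>)\<bar> \<le> e" using p(2)[OF UQ] by force
      then have "cmod (complex_of_real (\<phi> (U \<xi>) - p (U \<xi>))) * cmod (E \<xi>) \<le> e * cmod (E \<xi>)"
        unfolding norm_of_real by (rule mult_right_mono) simp
      then show "cmod (complex_of_real (\<phi> (U \<xi>)) * E \<xi> - complex_of_real (p (U \<xi>)) * E \<xi>) \<le> e * cmod (E \<xi>)"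
        by (simp only: norm_mult[symmetric] of_real_diff left_diff_distrib)
    qed (use int[OF \<phi>] int[OF contp] intE in auto)
    finally show ?thesis by (simp add: N_def)
  qed
  then have "cmod L \<le> 0"
  proof (cases "N = 0")
    case False
    show ?thesis
    proof (rule field_le_epsilon)
      fix e :: real assume "e > 0"
      then show "cmod L \<le> 0 + e"
        using \<open>\<And>e. e > 0 \<Longrightarrow> cmod L \<le> e * N\<close>[of "e / N"] False \<open>N \<ge> 0\<close> by auto
    qed
  qed (use \<open>\<And>e. e > 0 \<Longrightarrow> cmod L \<le> e * N\<close>[of 1] in auto)
  then show ?thesis by (simp add: L_def U_def E_def mult.assoc)
qed

text \<open>
  With the vectors \<open>Y j\<close> forming a basis, \<open>\<xi> \<mapsto> (exp (- (Y j \<bullet> \<xi>)))\<^sub>j\<close> is an injective change of variables into the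
  unit cube. The indicator of a compact set of frequencies is therefore a pointwise limit of bounded continuous
  functions of these exponentials, all of which annihilate \<open>f\<close>. Hence \<open>f\<close>, multiplied by one exponential to
  make it integrable, has vanishing integral over every compact set.
\<close>
lemma laplace_injective:
  fixes \<Omega> :: "(real ^ 'd) set"
  assumes \<Omega>: "open_pointed_cone \<Omega>" and f: "exp_tempered (dual_cone \<Omega>) f"
    and zero: "\<And>z. z \<in> tube \<Omega> \<Longrightarrow> laplace \<Omega> f z = 0"
  shows "AE \<xi> in lebesgue_on (dual_cone \<Omega>). f \<xi> = 0"
proof -
  let ?D = "dual_cone \<Omega>"
  let ?M = "lebesgue_on ?D"
  have "open \<Omega>" "\<Omega> \<noteq> {}" using \<Omega> by (auto simp: open_pointed_cone_def)
  then obtain Y :: "'d \<Rightarrow> real ^ 'd"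
    where Y: "\<And>j. Y j \<in> \<Omega>" and sep: "\<And>\<zeta>. (\<And>j. Y j \<bullet> \<zeta> = 0) \<Longrightarrow> \<zeta> = 0"
    by (rule open_set_contains_separating_vectors) blast
  obtain m where m: "m \<in> \<Omega>" using \<open>\<Omega> \<noteq> {}\<close> by blast
  define U where "U = (\<lambda>\<xi>::real^'d. \<chi> j. exp (- (Y j \<bullet> \<xi>)))"
  define E where "E = (\<lambda>\<xi>. complex_of_real (exp (- (m \<bullet> \<xi>))) * f \<xi>)"
  have contU: "continuous_on UNIV U" unfolding U_def by (intro continuous_intros)
  have injU: "inj U"
  proof (rule injI)
    fix \<xi> \<eta> assume "U \<xi> = U \<eta>"
    then have "Y j \<bullet> (\<xi> - \<eta>) = 0" for j by (auto simp: U_def vec_eq_iff inner_diff_right)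
    then show "\<xi> = \<eta>" using sep[of "\<xi> - \<eta>"] by simp
  qed
  have D: "?D \<in> sets lebesgue" using closed_dual_cone[of \<Omega>] by auto
  have intE: "integrable ?M E"
    using exp_tempered_integrable_exp[OF \<open>open \<Omega>\<close> f m, of "\<lambda>_. 1" 1] by (simp add: E_def)
  have K0: "(LINT \<xi>|?M. complex_of_real (indicator K \<xi>) * E \<xi>) = 0" if K: "compact K" for K
  proof (cases "K = {}")
    case False
    define T where "T = U ` K"
    have T: "closed T" "T \<noteq> {}"
      using K False contU continuous_on_subset unfolding T_def
      by (auto intro!: compact_imp_closed compact_continuous_image)
    \<comment> \<open>Continuous functions of the distance to the image of \<open>K\<close>, decreasing to its indicator.\<close>
    define \<phi> where "\<phi> k x = max 0 (1 - real k * infdist x T)" for k x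
    have cont\<phi>: "continuous_on UNIV (\<phi> k)" for k
      unfolding \<phi>_def by (intro continuous_intros)
    have lim: "(\<lambda>k. \<phi> k (U \<xi>)) \<longlonglongrightarrow> indicator K \<xi>" for \<xi>
    proof (cases "\<xi> \<in> K")
      case True
      then show ?thesis by (simp add: \<phi>_def T_def)
    next
      case False
      then have "U \<xi> \<notin> T" using injU by (auto simp: T_def inj_def)
      then have d: "infdist (U \<xi>) T > 0"
        using T in_closed_iff_infdist_zero infdist_nonneg by (metis less_eq_real_def)
      obtain k0 where k0: "1 < real k0 * infdist (U \<xi>) T" using reals_Archimedean3[OF d] by blast
      then have "\<forall>\<^sub>F k in sequentially. \<phi> k (U \<xi>) = 0"
        unfolding eventually_sequentially
      proof (intro exI[of _ k0] allI impI)
        fix k assume "k0 \<le> k"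
        then have "real k0 * infdist (U \<xi>) T \<le> real k * infdist (U \<xi>) T"
          using d by (intro mult_right_mono) auto
        then show "\<phi> k (U \<xi>) = 0" using k0 by (simp add: \<phi>_def)
      qed
      then show ?thesis using False by (simp add: tendsto_eventually)
    qed
    have "(\<lambda>k. LINT \<xi>|?M. complex_of_real (\<phi> k (U \<xi>)) * E \<xi>)
        \<longlonglongrightarrow> (LINT \<xi>|?M. complex_of_real (indicator K \<xi>) * E \<xi>)"
    proof (rule integral_dominated_convergence[where w="\<lambda>\<xi>. cmod (E \<xi>)"])
      have KD: "K \<in> sets lebesgue" using lmeasurable_compact[OF K] by (simp add: fmeasurable_def)
      have "(\<lambda>\<xi>. complex_of_real (indicator K \<xi>)) \<in> borel_measurable ?M"
        using KD by (intro measurable_restrict_space1) simp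
      then show "(\<lambda>\<xi>. complex_of_real (indicator K \<xi>) * E \<xi>) \<in> borel_measurable ?M"
        using intE by simp
      have "(\<lambda>\<xi>. \<phi> k (U \<xi>)) \<in> borel_measurable ?M" for k
        by (intro borel_measurable_lebesgue_on_continuous continuous_on_compose2[OF cont\<phi> contU]) auto
      then show "(\<lambda>\<xi>. complex_of_real (\<phi> k (U \<xi>)) * E \<xi>) \<in> borel_measurable ?M" for k
        using intE by simp
      show "AE \<xi> in ?M. (\<lambda>k. complex_of_real (\<phi> k (U \<xi>)) * E \<xi>) \<longlonglongrightarrow> complex_of_real (indicator K \<xi>) * E \<xi>"
        by (intro AE_I2 tendsto_intros lim)
      have "\<bar>\<phi> k x\<bar> \<le> 1" for k x by (simp add: \<phi>_def infdist_nonneg)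
      then show "AE \<xi> in ?M. cmod (complex_of_real (\<phi> k (U \<xi>)) * E \<xi>) \<le> cmod (E \<xi>)" for k
        by (intro AE_I2) (simp add: norm_mult mult_left_le_one_le)
    qed (use intE in simp)
    moreover have "(LINT \<xi>|?M. complex_of_real (\<phi> k (U \<xi>)) * E \<xi>) = 0" for k
      using continuous_of_exponentials_annihilates[where Y=Y, OF \<Omega> f zero Y cont\<phi> m]
      by (simp add: E_def U_def mult.assoc)
    ultimately have "(\<lambda>_::nat. 0) \<longlonglongrightarrow> (LINT \<xi>|?M. complex_of_real (indicator K \<xi>) * E \<xi>)"
      by simp
    then show ?thesis by (simp add: LIMSEQ_const_iff)
  qed simp
  have intK: "integrable ?M (\<lambda>\<xi>. complex_of_real (indicator K \<xi>) * E \<xi>)" if K: "compact K" "K \<subseteq> ?D" for K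
  proof -
    have "K \<in> sets ?M"
      using lmeasurable_compact[OF K(1)] D K(2) by (auto simp: fmeasurable_def sets_restrict_space_iff)
    from integrable_mult_indicator[OF this intE] show ?thesis by (simp add: scaleR_conv_of_real)
  qed
  \<comment> \<open>Applied to the real and imaginary parts and their negatives.\<close>
  have "AE \<xi> in ?M. r (E \<xi>) \<le> 0"
    if "bounded_linear r" for r :: "complex \<Rightarrow> real"
  proof (rule AE_nonpos_of_compact_integrals[OF D])
    interpret r: bounded_linear r by fact
    show "integrable ?M (\<lambda>\<xi>. r (E \<xi>))" using integrable_bounded_linear[OF that intE] .
    fix K assume K: "compact K" "K \<subseteq> ?D"
    have "(LINT \<xi>|?M. indicator K \<xi> * r (E \<xi>)) = (LINT \<xi>|?M. r (complex_of_real (indicator K \<xi>) * E \<xi>))"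
      by (simp add: r.scaleR flip: scaleR_conv_of_real)
    also have "\<dots> = r (LINT \<xi>|?M. complex_of_real (indicator K \<xi>) * E \<xi>)"
      by (rule integral_bounded_linear[OF that intK[OF K]])
    finally show "(LINT \<xi>|?M. indicator K \<xi> * r (E \<xi>)) = 0" using K0[OF K(1)] r.zero by simp
  qed
  from this[OF bounded_linear_Re] this[OF bounded_linear_minus[OF bounded_linear_Re]]
    this[OF bounded_linear_Im] this[OF bounded_linear_minus[OF bounded_linear_Im]]
  have "AE \<xi> in ?M. E \<xi> = 0" by eventually_elim (auto simp: complex_eq_iff)
  then show ?thesis by eventually_elim (simp add: E_def)
qed

section \<open>The inner product of the Hardy--Sobolev space\<close>

lemma hs_weight_ge_1: "1 \<le> hs_weight \<rho> n \<xi>"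
proof -
  have "(\<Sum>k\<in>{0}. \<rho> \<xi> ^ (2 * k)) \<le> (\<Sum>k\<le>n. \<rho> \<xi> ^ (2 * k))"
    by (rule sum_mono2) (auto simp: power_mult)
  then show ?thesis by (simp add: hs_weight_def)
qed

lemma hs_weight_nonneg [simp]: "0 \<le> hs_weight \<rho> n \<xi>"
  using hs_weight_ge_1[of \<rho> n \<xi>] by linarith

lemma hs_weight_measurable:
  assumes "admissible_gauge \<Omega> \<rho>"
  shows "hs_weight \<rho> n \<in> borel_measurable (lebesgue_on (dual_cone \<Omega>))"
proof -
  have "continuous_on (dual_cone \<Omega>) (hs_weight \<rho> n)"
    using assms unfolding hs_weight_def admissible_gauge_def by (intro continuous_intros) auto
  then show ?thesis
    using closed_dual_cone[of \<Omega>] by (intro continuous_imp_measurable_on_sets_lebesgue) auto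
qed

lemma weighted_L2_measurable:
  "f \<in> weighted_L2 \<Omega> \<rho> n \<Longrightarrow> f \<in> borel_measurable (lebesgue_on (dual_cone \<Omega>))"
  by (simp add: weighted_L2_def)

lemma mult_le_sum_squares:
  fixes a b :: real
  assumes "0 \<le> a" "0 \<le> b"
  shows "a * b \<le> a\<^sup>2 + b\<^sup>2"
  using sum_squares_bound[of a b] mult_nonneg_nonneg[OF assms] by (simp add: mult.assoc)

text \<open>
  Since the weight is at least one, this follows from \<open>a * b \<le> a\<^sup>2 + b\<^sup>2\<close> and the integrability of
  \<open>exp (- 2 * c * norm \<xi>)\<close>.
\<close>
lemma weighted_L2_exp_tempered:
  fixes \<Omega> :: "(real ^ 'd) set"
  assumes "f \<in> weighted_L2 \<Omega> \<rho> n"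
  shows "exp_tempered (dual_cone \<Omega>) f"
  unfolding exp_tempered_def
proof (intro conjI allI impI)
  let ?M = "lebesgue_on (dual_cone \<Omega>)"
  show m: "f \<in> borel_measurable ?M" using assms by (rule weighted_L2_measurable)
  fix c :: real assume "c > 0"
  then have "integrable ?M (\<lambda>\<xi>. exp (- (2 * c) * norm \<xi>))"
    using closed_dual_cone[of \<Omega>] by (intro integrable_exp_neg_norm) auto
  with assms have "integrable ?M (\<lambda>\<xi>. exp (- (2 * c) * norm \<xi>) + (cmod (f \<xi>))\<^sup>2 * hs_weight \<rho> n \<xi>)"
    by (simp add: weighted_L2_def)
  moreover have "(\<lambda>\<xi>. exp (- c * norm \<xi>) * cmod (f \<xi>)) \<in> borel_measurable ?M"
    by (intro borel_measurable_times borel_measurable_lebesgue_on_continuous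
        measurable_compose[OF m borel_measurable_norm] continuous_intros)
  ultimately show "integrable ?M (\<lambda>\<xi>. exp (- c * norm \<xi>) * cmod (f \<xi>))"
  proof (rule Bochner_Integration.integrable_bound, intro AE_I2)
    fix \<xi>
    define a b where "a = exp (- c * norm \<xi>)" and "b = cmod (f \<xi>)"
    have "a * b \<le> a\<^sup>2 + b\<^sup>2" and "0 \<le> a * b"
      by (auto simp: a_def b_def intro: mult_le_sum_squares)
    moreover have "a\<^sup>2 = exp (- (2 * c) * norm \<xi>)"
      by (simp add: a_def power2_eq_square flip: exp_add)
    moreover have "b\<^sup>2 \<le> b\<^sup>2 * hs_weight \<rho> n \<xi>"
      using mult_left_mono[OF hs_weight_ge_1, of "b\<^sup>2"] by simp
    ultimately show "norm (exp (- c * norm \<xi>) * cmod (f \<xi>))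
        \<le> norm (exp (- (2 * c) * norm \<xi>) + (cmod (f \<xi>))\<^sup>2 * hs_weight \<rho> n \<xi>)"
      unfolding a_def b_def by simp
  qed
qed

lemma laplace_diff:
  assumes "open \<Omega>" "z \<in> tube \<Omega>" "exp_tempered (dual_cone \<Omega>) f" "exp_tempered (dual_cone \<Omega>) g"
  shows "laplace \<Omega> (\<lambda>\<xi>. f \<xi> - g \<xi>) z = laplace \<Omega> f z - laplace \<Omega> g z"
proof -
  obtain c where c: "c > 0"
    "\<And>\<xi>. \<xi> \<in> dual_cone \<Omega> \<Longrightarrow> cmod (exp (\<i> * bilin z \<xi>)) \<le> exp (- c * norm \<xi>)"
    using laplace_kernel_decay assms(1,2) by blast
  have "integrable (lebesgue_on (dual_cone \<Omega>)) (\<lambda>\<xi>. exp (\<i> * bilin z \<xi>) * h \<xi>)"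
    if "exp_tempered (dual_cone \<Omega>) h" for h
    using c by (intro exp_tempered_integrable[OF that, of c _ 1]
        borel_measurable_lebesgue_on_continuous continuous_intros) auto
  then show ?thesis using assms(3,4) by (simp add: laplace_def right_diff_distrib)
qed

lemma hs_density:
  assumes "F \<in> hardy_sobolev \<Omega> \<rho> n"
  shows hs_density_weighted_L2: "hs_density \<Omega> \<rho> n F \<in> weighted_L2 \<Omega> \<rho> n"
    and laplace_hs_density: "\<And>z. z \<in> tube \<Omega> \<Longrightarrow> laplace \<Omega> (hs_density \<Omega> \<rho> n F) z = F z"
proof -
  have "\<exists>f. f \<in> weighted_L2 \<Omega> \<rho> n \<and> (\<forall>z\<in>tube \<Omega>. F z = laplace \<Omega> f z)"
    using assms by (auto simp: hardy_sobolev_def)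
  from someI_ex[OF this]
  show "hs_density \<Omega> \<rho> n F \<in> weighted_L2 \<Omega> \<rho> n"
    "\<And>z. z \<in> tube \<Omega> \<Longrightarrow> laplace \<Omega> (hs_density \<Omega> \<rho> n F) z = F z"
    unfolding hs_density_def by auto
qed

text \<open>
  Injectivity makes the inner product independent of the chosen density, which is what allows it to be computed
  from any known density of the kernel function.
\<close>
lemma hs_density_unique:
  assumes "open_pointed_cone \<Omega>" "F \<in> hardy_sobolev \<Omega> \<rho> n" "g \<in> weighted_L2 \<Omega> \<rho> n"
    and "\<And>z. z \<in> tube \<Omega> \<Longrightarrow> F z = laplace \<Omega> g z"
  shows "AE \<xi> in lebesgue_on (dual_cone \<Omega>). hs_density \<Omega> \<rho> n F \<xi> = g \<xi>"
proof -
  have "open \<Omega>" using assms(1) by (simp add: open_pointed_cone_def)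
  have t: "exp_tempered (dual_cone \<Omega>) (hs_density \<Omega> \<rho> n F)" "exp_tempered (dual_cone \<Omega>) g"
    using assms(2,3) by (blast intro: weighted_L2_exp_tempered hs_density_weighted_L2)+
  have "AE \<xi> in lebesgue_on (dual_cone \<Omega>). hs_density \<Omega> \<rho> n F \<xi> - g \<xi> = 0"
    using assms(2,4) by (intro laplace_injective[OF assms(1) exp_tempered_diff[OF t]])
      (simp add: laplace_diff[OF \<open>open \<Omega>\<close> _ t] laplace_hs_density)
  then show ?thesis by simp
qed

lemma integrable_weighted_inner:
  assumes "admissible_gauge \<Omega> \<rho>" "f \<in> weighted_L2 \<Omega> \<rho> n" "g \<in> weighted_L2 \<Omega> \<rho> n"
  shows "integrable (lebesgue_on (dual_cone \<Omega>))
     (\<lambda>\<xi>. f \<xi> * cnj (g \<xi>) * complex_of_real (hs_weight \<rho> n \<xi>))"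
proof (rule Bochner_Integration.integrable_bound)
  let ?M = "lebesgue_on (dual_cone \<Omega>)"
  show "integrable ?M (\<lambda>\<xi>. (cmod (f \<xi>))\<^sup>2 * hs_weight \<rho> n \<xi> + (cmod (g \<xi>))\<^sup>2 * hs_weight \<rho> n \<xi>)"
    using assms(2,3) by (simp add: weighted_L2_def)
  have "(\<lambda>\<xi>. cnj (g \<xi>)) \<in> borel_measurable ?M"
    using weighted_L2_measurable[OF assms(3)] borel_measurable_continuous_onI[of cnj]
    by (auto intro: measurable_compose continuous_intros)
  then show "(\<lambda>\<xi>. f \<xi> * cnj (g \<xi>) * complex_of_real (hs_weight \<rho> n \<xi>)) \<in> borel_measurable ?M"
    using weighted_L2_measurable[OF assms(2)] hs_weight_measurable[OF assms(1), of n] by simp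
  show "AE \<xi> in ?M. norm (f \<xi> * cnj (g \<xi>) * complex_of_real (hs_weight \<rho> n \<xi>))
      \<le> norm ((cmod (f \<xi>))\<^sup>2 * hs_weight \<rho> n \<xi> + (cmod (g \<xi>))\<^sup>2 * hs_weight \<rho> n \<xi>)"
  proof (rule AE_I2)
    fix \<xi>
    have "cmod (f \<xi>) * cmod (g \<xi>) \<le> (cmod (f \<xi>))\<^sup>2 + (cmod (g \<xi>))\<^sup>2"
      by (intro mult_le_sum_squares) auto
    then have "cmod (f \<xi>) * cmod (g \<xi>) * hs_weight \<rho> n \<xi>
        \<le> ((cmod (f \<xi>))\<^sup>2 + (cmod (g \<xi>))\<^sup>2) * hs_weight \<rho> n \<xi>"
      by (rule mult_right_mono) simp
    then show "norm (f \<xi> * cnj (g \<xi>) * complex_of_real (hs_weight \<rho> n \<xi>))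
      \<le> norm ((cmod (f \<xi>))\<^sup>2 * hs_weight \<rho> n \<xi> + (cmod (g \<xi>))\<^sup>2 * hs_weight \<rho> n \<xi>)"
      by (simp add: norm_mult distrib_right)
  qed
qed

section \<open>The reproducing kernel\<close>

text \<open>
  The factor \<open>1 / hs_weight\<close> cancels the weight of the inner product, so that pairing a density \<open>f\<close> with this
  function leaves \<open>\<integral> exp (i \<langle>w, \<xi>\<rangle>) f\<close>, the value of the Laplace transform of \<open>f\<close> at \<open>w\<close>.
\<close>
definition kernel_density :: "(real ^ 'd \<Rightarrow> real) \<Rightarrow> nat \<Rightarrow> complex ^ 'd \<Rightarrow> real ^ 'd \<Rightarrow> complex" where
  "kernel_density \<rho> n w \<xi> = cnj (exp (\<i> * bilin w \<xi>)) / complex_of_real (hs_weight \<rho> n \<xi>)"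

lemma kernel_density_weighted_L2:
  fixes \<Omega> :: "(real ^ 'd) set"
  assumes "open \<Omega>" "admissible_gauge \<Omega> \<rho>" "w \<in> tube \<Omega>"
  shows "kernel_density \<rho> n w \<in> weighted_L2 \<Omega> \<rho> n"
proof -
  let ?M = "lebesgue_on (dual_cone \<Omega>)"
  obtain c where c: "c > 0"
    "\<And>\<xi>. \<xi> \<in> dual_cone \<Omega> \<Longrightarrow> cmod (exp (\<i> * bilin w \<xi>)) \<le> exp (- c * norm \<xi>)"
    using laplace_kernel_decay assms(1,3) by blast
  note mw = hs_weight_measurable[OF assms(2), of n]
  have "(\<lambda>\<xi>. cnj (exp (\<i> * bilin w \<xi>))) \<in> borel_measurable ?M"
    by (intro borel_measurable_lebesgue_on_continuous continuous_intros)
  then have m: "kernel_density \<rho> n w \<in> borel_measurable ?M"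
    unfolding kernel_density_def using mw by simp
  have "integrable ?M (\<lambda>\<xi>. (cmod (kernel_density \<rho> n w \<xi>))\<^sup>2 * hs_weight \<rho> n \<xi>)"
  proof (rule Bochner_Integration.integrable_bound)
    show "integrable ?M (\<lambda>\<xi>. exp (- (2 * c) * norm \<xi>))"
      using closed_dual_cone[of \<Omega>] c(1) by (intro integrable_exp_neg_norm) auto
    show "(\<lambda>\<xi>. (cmod (kernel_density \<rho> n w \<xi>))\<^sup>2 * hs_weight \<rho> n \<xi>) \<in> borel_measurable ?M"
      using m mw by simp
    show "AE \<xi> in ?M. norm ((cmod (kernel_density \<rho> n w \<xi>))\<^sup>2 * hs_weight \<rho> n \<xi>)
        \<le> norm (exp (- (2 * c) * norm \<xi>))"
    proof (rule AE_I2)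
      fix \<xi> assume "\<xi> \<in> space ?M"
      then have le: "(cmod (exp (\<i> * bilin w \<xi>)))\<^sup>2 \<le> (exp (- c * norm \<xi>))\<^sup>2"
        using c(2) by (intro power_mono) auto
      have h: "1 \<le> hs_weight \<rho> n \<xi>" by (rule hs_weight_ge_1)
      have "(cmod (kernel_density \<rho> n w \<xi>))\<^sup>2 * hs_weight \<rho> n \<xi>
          = (cmod (exp (\<i> * bilin w \<xi>)))\<^sup>2 / hs_weight \<rho> n \<xi>"
        using h unfolding kernel_density_def norm_divide complex_mod_cnj
        by (simp add: power2_eq_square field_simps del: norm_exp_eq_Re)
      also have "\<dots> \<le> (cmod (exp (\<i> * bilin w \<xi>)))\<^sup>2 / 1"
        using h by (intro divide_left_mono) auto
      also have "\<dots> \<le> exp (- (2 * c) * norm \<xi>)"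
        using le by (simp add: power2_eq_square mult.assoc del: norm_exp_eq_Re flip: exp_add)
      finally show "norm ((cmod (kernel_density \<rho> n w \<xi>))\<^sup>2 * hs_weight \<rho> n \<xi>)
        \<le> norm (exp (- (2 * c) * norm \<xi>))" by simp
    qed
  qed
  with m show ?thesis by (simp add: weighted_L2_def)
qed

lemma laplace_in_hardy_sobolev:
  assumes "open \<Omega>" "f \<in> weighted_L2 \<Omega> \<rho> n"
  shows "restrict (laplace \<Omega> f) (tube \<Omega>) \<in> hardy_sobolev \<Omega> \<rho> n"
proof -
  have h: "holomorphic_several (laplace \<Omega> f) (tube \<Omega>)"
    using assms by (blast intro: holomorphic_several_laplace weighted_L2_exp_tempered)
  have "holomorphic_several (restrict (laplace \<Omega> f) (tube \<Omega>)) (tube \<Omega>)"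
    unfolding holomorphic_several_def
  proof
    fix z assume z: "z \<in> tube \<Omega>"
    then obtain D where D: "(laplace \<Omega> f has_derivative D) (at z)" "\<forall>c v. D (c *s v) = c * D v"
      using h by (auto simp: holomorphic_several_def)
    have "(restrict (laplace \<Omega> f) (tube \<Omega>) has_derivative D) (at z)"
      by (rule has_derivative_transform_within_open[OF D(1) open_tube[OF assms(1)] z]) simp
    with D(2) show "\<exists>D. (restrict (laplace \<Omega> f) (tube \<Omega>) has_derivative D) (at z) \<and>
        (\<forall>c v. D (c *s v) = c * D v)" by blast
  qed
  with assms(2) show ?thesis by (auto simp: hardy_sobolev_def)
qed

lemma kernel_reproducing:
  assumes \<Omega>: "open_pointed_cone \<Omega>" and \<rho>: "admissible_gauge \<Omega> \<rho>" and w: "w \<in> tube \<Omega>"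
    and F: "F \<in> hardy_sobolev \<Omega> \<rho> n"
  shows "F w = hs_inner \<Omega> \<rho> n F (restrict (laplace \<Omega> (kernel_density \<rho> n w)) (tube \<Omega>))"
proof -
  let ?M = "lebesgue_on (dual_cone \<Omega>)"
  let ?K = "restrict (laplace \<Omega> (kernel_density \<rho> n w)) (tube \<Omega>)"
  let ?f = "hs_density \<Omega> \<rho> n F"
  have "open \<Omega>" using \<Omega> by (simp add: open_pointed_cone_def)
  note kL2 = kernel_density_weighted_L2[OF \<open>open \<Omega>\<close> \<rho> w, of n]
  note K = laplace_in_hardy_sobolev[OF \<open>open \<Omega>\<close> kL2]
  have fL2: "?f \<in> weighted_L2 \<Omega> \<rho> n" using F by (rule hs_density_weighted_L2)
  have ae: "AE \<xi> in ?M. hs_density \<Omega> \<rho> n ?K \<xi> = kernel_density \<rho> n w \<xi>"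
    by (rule hs_density_unique[OF \<Omega> K kL2]) simp
  have "hs_inner \<Omega> \<rho> n F ?K =
      (LINT \<xi>|?M. ?f \<xi> * cnj (kernel_density \<rho> n w \<xi>) * complex_of_real (hs_weight \<rho> n \<xi>))"
    unfolding hs_inner_def
  proof (rule integral_cong_AE)
    show "AE \<xi> in ?M. ?f \<xi> * cnj (hs_density \<Omega> \<rho> n ?K \<xi>) * complex_of_real (hs_weight \<rho> n \<xi>)
        = ?f \<xi> * cnj (kernel_density \<rho> n w \<xi>) * complex_of_real (hs_weight \<rho> n \<xi>)"
      using ae by eventually_elim simp
  qed (use integrable_weighted_inner[OF \<rho> fL2 kL2]
      integrable_weighted_inner[OF \<rho> fL2 hs_density_weighted_L2[OF K]] in auto)
  also have "\<dots> = laplace \<Omega> ?f w"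
    unfolding laplace_def
  proof (rule Bochner_Integration.integral_cong[OF refl])
    fix \<xi>
    have "hs_weight \<rho> n \<xi> \<noteq> 0" using hs_weight_ge_1[of \<rho> n \<xi>] by linarith
    then show "?f \<xi> * cnj (kernel_density \<rho> n w \<xi>) * complex_of_real (hs_weight \<rho> n \<xi>)
        = exp (\<i> * bilin w \<xi>) * ?f \<xi>"
      by (simp add: kernel_density_def)
  qed
  also have "\<dots> = F w" using laplace_hs_density[OF F w] .
  finally show ?thesis ..
qed

lemma hs_inner_self:
  "hs_inner \<Omega> \<rho> n F F = complex_of_real
     (LINT \<xi>|lebesgue_on (dual_cone \<Omega>). (cmod (hs_density \<Omega> \<rho> n F \<xi>))\<^sup>2 * hs_weight \<rho> n \<xi>)"
  unfolding hs_inner_def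
  by (simp flip: integral_complex_of_real complex_norm_square)

text \<open>
  The squared distance of the two functions expands into four inner products. Each of them is the value at \<open>w\<close>
  of its first argument, so they cancel in pairs.
\<close>
lemma reproducing_unique:
  assumes \<rho>: "admissible_gauge \<Omega> \<rho>"
    and G: "G \<in> hardy_sobolev \<Omega> \<rho> n" "\<And>F. F \<in> hardy_sobolev \<Omega> \<rho> n \<Longrightarrow> F w = hs_inner \<Omega> \<rho> n F G"
    and H: "H \<in> hardy_sobolev \<Omega> \<rho> n" "\<And>F. F \<in> hardy_sobolev \<Omega> \<rho> n \<Longrightarrow> F w = hs_inner \<Omega> \<rho> n F H"
  shows "G = H"
proof -
  let ?M = "lebesgue_on (dual_cone \<Omega>)"
  define g h where "g = hs_density \<Omega> \<rho> n G" and "h = hs_density \<Omega> \<rho> n H"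
  define W where "W = (\<lambda>\<xi>. complex_of_real (hs_weight \<rho> n \<xi>))"
  have gh: "g \<in> weighted_L2 \<Omega> \<rho> n" "h \<in> weighted_L2 \<Omega> \<rho> n"
    unfolding g_def h_def using G(1) H(1) by (auto intro: hs_density_weighted_L2)
  have ints: "integrable ?M (\<lambda>\<xi>. g \<xi> * cnj (g \<xi>) * W \<xi>)" "integrable ?M (\<lambda>\<xi>. g \<xi> * cnj (h \<xi>) * W \<xi>)"
    "integrable ?M (\<lambda>\<xi>. h \<xi> * cnj (g \<xi>) * W \<xi>)" "integrable ?M (\<lambda>\<xi>. h \<xi> * cnj (h \<xi>) * W \<xi>)"
    unfolding W_def using gh by (auto intro: integrable_weighted_inner[OF \<rho>])
  let ?q = "\<lambda>\<xi>. (cmod (g \<xi> - h \<xi>))\<^sup>2 * hs_weight \<rho> n \<xi>"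
  have q: "complex_of_real (?q \<xi>) = g \<xi> * cnj (g \<xi>) * W \<xi> - g \<xi> * cnj (h \<xi>) * W \<xi>
      - h \<xi> * cnj (g \<xi>) * W \<xi> + h \<xi> * cnj (h \<xi>) * W \<xi>" for \<xi>
  proof -
    have "complex_of_real ((cmod (g \<xi> - h \<xi>))\<^sup>2) = (g \<xi> - h \<xi>) * cnj (g \<xi> - h \<xi>)"
      by (rule complex_norm_square)
    then have "complex_of_real (?q \<xi>) = (g \<xi> - h \<xi>) * cnj (g \<xi> - h \<xi>) * W \<xi>"
      by (simp only: of_real_mult W_def)
    also have "\<dots> = g \<xi> * cnj (g \<xi>) * W \<xi> - g \<xi> * cnj (h \<xi>) * W \<xi>
      - h \<xi> * cnj (g \<xi>) * W \<xi> + h \<xi> * cnj (h \<xi>) * W \<xi>"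
      by (simp add: algebra_simps)
    finally show ?thesis .
  qed
  have "integrable ?M (\<lambda>\<xi>. complex_of_real (?q \<xi>))" unfolding q using ints by simp
  then have iq: "integrable ?M ?q" by (simp only: complex_of_real_integrable_eq)
  have "complex_of_real (LINT \<xi>|?M. ?q \<xi>) = (LINT \<xi>|?M. complex_of_real (?q \<xi>))"
    by (simp only: integral_complex_of_real)
  also have "\<dots> = hs_inner \<Omega> \<rho> n G G - hs_inner \<Omega> \<rho> n G H - hs_inner \<Omega> \<rho> n H G + hs_inner \<Omega> \<rho> n H H"
    unfolding q using ints by (simp add: hs_inner_def W_def g_def h_def)
  also have "\<dots> = 0"
    using G(2)[OF G(1)] G(2)[OF H(1)] H(2)[OF G(1)] H(2)[OF H(1)] by simp
  finally have "(LINT \<xi>|?M. ?q \<xi>) = 0" by simp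
  then have "AE \<xi> in ?M. ?q \<xi> = 0"
    using integral_nonneg_eq_0_iff_AE[OF iq] by simp
  then have ae: "AE \<xi> in ?M. g \<xi> = h \<xi>"
  proof eventually_elim
    case (elim \<xi>)
    then show ?case using hs_weight_ge_1[of \<rho> n \<xi>] by auto
  qed
  show ?thesis
  proof (rule extensionalityI[where A="tube \<Omega>"])
    show "G \<in> extensional (tube \<Omega>)" "H \<in> extensional (tube \<Omega>)"
      using G(1) H(1) by (auto simp: hardy_sobolev_def)
    fix z assume z: "z \<in> tube \<Omega>"
    have e: "(\<lambda>\<xi>. exp (\<i> * bilin z \<xi>)) \<in> borel_measurable ?M"
      by (intro borel_measurable_lebesgue_on_continuous continuous_intros)
    have "laplace \<Omega> g z = laplace \<Omega> h z"
      unfolding laplace_def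
      using ae e gh[THEN weighted_L2_measurable] by (intro integral_cong_AE) auto
    then show "G z = H z"
      using laplace_hs_density[OF G(1) z] laplace_hs_density[OF H(1) z] by (simp add: g_def h_def)
  qed
qed

lemma hs_kernel_at:
  assumes \<Omega>: "open_pointed_cone \<Omega>" and \<rho>: "admissible_gauge \<Omega> \<rho>" and w: "w \<in> tube \<Omega>"
  shows hs_kernel_at_in_hardy_sobolev: "hs_kernel_at \<Omega> \<rho> n w \<in> hardy_sobolev \<Omega> \<rho> n"
    and hs_kernel_at_reproducing:
      "\<And>F. F \<in> hardy_sobolev \<Omega> \<rho> n \<Longrightarrow> F w = hs_inner \<Omega> \<rho> n F (hs_kernel_at \<Omega> \<rho> n w)"
proof -
  let ?P = "\<lambda>G. G \<in> hardy_sobolev \<Omega> \<rho> n \<and>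
        (\<forall>F\<in>hardy_sobolev \<Omega> \<rho> n. F w = hs_inner \<Omega> \<rho> n F G)"
  have "open \<Omega>" using \<Omega> by (simp add: open_pointed_cone_def)
  have "\<exists>!G. ?P G"
  proof (rule ex1I)
    show "?P (restrict (laplace \<Omega> (kernel_density \<rho> n w)) (tube \<Omega>))"
      using laplace_in_hardy_sobolev[OF \<open>open \<Omega>\<close> kernel_density_weighted_L2[OF \<open>open \<Omega>\<close> \<rho> w]]
        kernel_reproducing[OF \<Omega> \<rho> w] by blast
    then show "G = restrict (laplace \<Omega> (kernel_density \<rho> n w)) (tube \<Omega>)" if "?P G" for G
      using that by (intro reproducing_unique[OF \<rho>]) blast+
  qed
  from theI'[OF this, folded hs_kernel_at_def]
  show "hs_kernel_at \<Omega> \<rho> n w \<in> hardy_sobolev \<Omega> \<rho> n"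
    "\<And>F. F \<in> hardy_sobolev \<Omega> \<rho> n \<Longrightarrow> F w = hs_inner \<Omega> \<rho> n F (hs_kernel_at \<Omega> \<rho> n w)"
    by blast+
qed

section \<open>Carleson measures tested on reproducing kernels\<close>

theorem proposition7p4:
  fixes \<Omega> :: "(real ^ 'd) set" and \<rho> :: "real ^ 'd \<Rightarrow> real"
    and n :: nat and \<mu> :: "(complex ^ 'd) measure"
  assumes "open_pointed_cone \<Omega>"
    and "admissible_gauge \<Omega> \<rho>"
    and "carleson_measure \<Omega> \<rho> n \<mu>"
  shows "\<exists>C>0. \<forall>w\<in>tube \<Omega>.
           hs_kernel \<Omega> \<rho> n w w \<in> \<real> \<and>
           (\<integral>\<^sup>+ z. ennreal ((cmod (hs_kernel_at \<Omega> \<rho> n w z))\<^sup>2) \<partial>\<mu>)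
             \<le> ennreal (C * Re (hs_kernel \<Omega> \<rho> n w w))"
proof -
  obtain C where C: "C > 0" and carleson: "\<And>F. F \<in> hardy_sobolev \<Omega> \<rho> n \<Longrightarrow>
        (\<integral>\<^sup>+ z. ennreal ((cmod (F z))\<^sup>2) \<partial>\<mu>) \<le> ennreal (C * (hs_norm \<Omega> \<rho> n F)\<^sup>2)"
    using assms(3) by (auto simp: carleson_measure_def)
  show ?thesis
  proof (intro exI[of _ C] conjI ballI C)
    fix w assume w: "w \<in> tube \<Omega>"
    let ?K = "hs_kernel_at \<Omega> \<rho> n w"
    have K: "?K \<in> hardy_sobolev \<Omega> \<rho> n"
      by (rule hs_kernel_at_in_hardy_sobolev[OF assms(1,2) w])
    have diag: "hs_kernel \<Omega> \<rho> n w w = hs_inner \<Omega> \<rho> n ?K ?K"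
      unfolding hs_kernel_def by (rule hs_kernel_at_reproducing[OF assms(1,2) w K])
    show "hs_kernel \<Omega> \<rho> n w w \<in> \<real>"
      unfolding diag hs_inner_self by simp
    have "0 \<le> Re (hs_inner \<Omega> \<rho> n ?K ?K)"
      unfolding hs_inner_self by simp
    then have "(hs_norm \<Omega> \<rho> n ?K)\<^sup>2 = Re (hs_kernel \<Omega> \<rho> n w w)"
      by (simp add: hs_norm_def diag)
    with carleson[OF K]
    show "(\<integral>\<^sup>+ z. ennreal ((cmod (?K z))\<^sup>2) \<partial>\<mu>) \<le> ennreal (C * Re (hs_kernel \<Omega> \<rho> n w w))"
      by simp
  qed
qed

end
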